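(* Consider the cache-aided combination network with secure caching described in the context, with relay cache size $0\le N\le \frac Dr$. Let $t\in\{0,1,\dots,\hat K-1\}$ and $$M=\frac{tD}{\hat K-t}\Big(1-\frac{Nr}{D}\Big).$$ Then, with user cache size $M$ and relay cache size $N$, the rate pair $$R_1^c=\frac{\hat K(D+M-rN)}{r\big((\hat K+1)M+D-rN\big)}\Big(1-\frac{Nr}{D}\Big),\qquad R_2^c=\frac1r$$ is achievable under the secure caching constraint. Moreover, for fixed $N$, every point of the convex envelope of the resulting set of triples $(M,R_1^c,R_2^c)$ is achievable under this constraint.
   Context: Combination network: a server holds $D$ independent files $W_1,\dots,W_D$, each uniformly distributed over $F$ bits. There are $h$ relay nodes $\Gamma_1,\dots,\Gamma_h$ and $K=\binom{h}{r}$ end users $U_1,\dots,U_K$ ($r<h$); each user is connected to a distinct set of $r$ relays (one user per $r$-subset), so each relay is connected to $\hat K=\binom{h-1}{r-1}$ users; $\mathcal N(U_k)$ denotes the set of relays connected to user $k$. The server is connected to every relay; all links are noiseless unicast links. Assume $K\le D$. Each user has a cache of $MF$ bits, each relay a cache of $NF$ bits. Placement phase (before demands): relay caches $V_j$ and user caches $Z_k$ are filled with functions of the files (and possibly of randomness independent of the files), $H(V_j)\le NF$, $H(Z_k)\le MF$. Delivery: user $k$ requests $W_{d_k}$ for an arbitrary $\mathbf d\in\{1,\dots,D\}^K$; the server sends relay $\Gamma_i$ a signal $X_{i,\mathbf d}$ of $R_1F$ bits; relay $\Gamma_i$ sends each connected user $k$ a signal $Y_{i,\mathbf d,k}$ of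 $R_2F$ bits, a function of $X_{i,\mathbf d}$, $V_i$, $\mathbf d$; user $k$ decodes $W_{d_k}$ from $Z_k$, $\mathbf d$ and $\{Y_{j,\mathbf d,k}:j\in\mathcal N(U_k)\}$. Secure caching: with $\mathbf W_{-d_k}$ the set of all files other than $W_{d_k}$, require $\max_{\mathbf d,k} I(\mathbf W_{-d_k};\{Y_{j,\mathbf d,k}:j\in\mathcal N(U_k)\},Z_k)<\delta$. A pair is achievable under secure caching if for every $\epsilon,\delta>0$ and all sufficiently large $F$ there is a scheme with these rates, $\max_{\mathbf d,k}P(\hat W_{d_k}\ne W_{d_k})<\epsilon$, and the secure caching condition with $\delta$. *)

theory Defs
  imports "HOL-Probability.Probability"
begin

definition files :: "nat \<Rightarrow> nat \<Rightarrow> bool list list set" where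
  "files D F = {ws. length ws = D \<and> (\<forall>w\<in>set ws. length w = F)}"

(* Users are identified with the r-subsets of the relays {0..<h}; N(U_S) = S. *)
definition users :: "nat \<Rightarrow> nat \<Rightarrow> nat set set" where
  "users h r = {S. S \<subseteq> {..<h} \<and> card S = r}"

definition demands :: "nat \<Rightarrow> nat \<Rightarrow> nat \<Rightarrow> (nat set \<Rightarrow> nat) set" where
  "demands h r D = {d. \<forall>S\<in>users h r. d S < D}"

definition ent :: "'a pmf \<Rightarrow> ('a \<Rightarrow> 'b) \<Rightarrow> real" where
  "ent P X = (\<Sum>y\<in>X ` set_pmf P. - pmf (map_pmf X P) y * log 2 (pmf (map_pmf X P) y))"

definition mi :: "'a pmf \<Rightarrow> ('a \<Rightarrow> 'b) \<Rightarrow> ('a \<Rightarrow> 'c) \<Rightarrow> real" where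
  "mi P X Y = ent P X + ent P Y - ent P (\<lambda>\<omega>. (X \<omega>, Y \<omega>))"

(* Achievability of (M, N, R1, R2) under secure caching.
   Sample space: (files, placement/delivery randomness u), files uniform on files D F,
   u ~ rho independent of the files.
   V j : relay cache, Z S : user cache, X j d : server -> relay j signal,
   Y j d S x v : relay j -> user S signal (function of X_{j,d}, V_j, d),
   dec d S z y : decoder of user S from Z_S, d and the signals of the relays in S. *)
definition secure_achievable ::
  "nat \<Rightarrow> nat \<Rightarrow> nat \<Rightarrow> real \<Rightarrow> real \<Rightarrow> real \<Rightarrow> real \<Rightarrow> bool" where
  "secure_achievable h r D M N R1 R2 \<longleftrightarrow>
    (\<forall>\<epsilon>>0. \<forall>\<delta>>0. \<exists>F0. \<forall>F\<ge>F0.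
      \<exists>(\<rho> :: nat pmf)
       (V :: nat \<Rightarrow> bool list list \<Rightarrow> nat \<Rightarrow> bool list)
       (Z :: nat set \<Rightarrow> bool list list \<Rightarrow> nat \<Rightarrow> bool list)
       (X :: nat \<Rightarrow> (nat set \<Rightarrow> nat) \<Rightarrow> bool list list \<Rightarrow> nat \<Rightarrow> bool list)
       (Y :: nat \<Rightarrow> (nat set \<Rightarrow> nat) \<Rightarrow> nat set \<Rightarrow> bool list \<Rightarrow> bool list \<Rightarrow> bool list)
       (dec :: (nat set \<Rightarrow> nat) \<Rightarrow> nat set \<Rightarrow> bool list \<Rightarrow> (nat \<Rightarrow> bool list) \<Rightarrow> bool list).
        finite (set_pmf \<rho>) \<and>
        (let P = pair_pmf (pmf_of_set (files D F)) \<rho>;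
             rcv = (\<lambda>d S ws u. (\<lambda>j. if j \<in> S then Y j d S (X j d ws u) (V j ws u) else []))
         in (\<forall>j<h. ent P (\<lambda>(ws, u). V j ws u) \<le> N * real F) \<and>
            (\<forall>S\<in>users h r. ent P (\<lambda>(ws, u). Z S ws u) \<le> M * real F) \<and>
            (\<forall>j d ws u. length (X j d ws u) \<le> nat \<lceil>R1 * real F\<rceil>) \<and>
            (\<forall>j d S x v. length (Y j d S x v) \<le> nat \<lceil>R2 * real F\<rceil>) \<and>
            (\<forall>d\<in>demands h r D. \<forall>S\<in>users h r.
               measure_pmf.prob P {(ws, u). dec d S (Z S ws u) (rcv d S ws u) \<noteq> ws ! d S} < \<epsilon> \<and>
               mi P (\<lambda>(ws, u). nths ws (- {d S}))
                    (\<lambda>(ws, u). (Z S ws u, rcv d S ws u)) < \<delta>)))"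

definition Khat :: "nat \<Rightarrow> nat \<Rightarrow> nat" where
  "Khat h r = (h - 1) choose (r - 1)"

definition Mc :: "nat \<Rightarrow> nat \<Rightarrow> nat \<Rightarrow> real \<Rightarrow> nat \<Rightarrow> real" where
  "Mc h r D N t = real t * real D / (real (Khat h r) - real t) * (1 - N * real r / real D)"

definition R1c :: "nat \<Rightarrow> nat \<Rightarrow> nat \<Rightarrow> real \<Rightarrow> nat \<Rightarrow> real" where
  "R1c h r D N t = (let M = Mc h r D N t; K = real (Khat h r) in
     K * (real D + M - real r * N) / (real r * ((K + 1) * M + real D - real r * N))
       * (1 - N * real r / real D))"

end

theory Submission
  imports Defs "HOL-Number_Theory.Cong" "HOL-Computational_Algebra.Polynomial" "HOL-Real_Asymp.Real_Asymp"
begin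

text \<open>
  Codes over arbitrary finite alphabets can be used side by side, which multiplies the sizes of their
  alphabets. Hence the region of their rates is convex, and the rates of the theorem are convex combinations
  of two corner points, with weights \<open>N r / D\<close> and \<open>1 - N r / D\<close>.

  At both corners each file is encoded by a Reed-Solomon code across the relays, any \<open>r\<close> of which determine
  it. For \<open>N = D / r\<close> the relays just cache their code symbols. For \<open>N = 0\<close> a relay symbol is secret-shared
  among the \<open>t\<close>-subsets of the users of that relay; a user caches the shares of the subsets it belongs to,
  and the server sends to the relay, for each \<open>(t + 1)\<close>-subset \<open>T\<close>, the sum over \<open>S \<in> T\<close> of the share
  \<open>T - {S}\<close> of the file that \<open>S\<close> requests. The relay forwards to a user only the sums involving it, so the
  transmissions need no encryption. Changing the files that a user did not request can be undone, in the
  view of that user, by a translation of the keys of the secret sharing; hence the leakage is exactly zero.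

  The rates have to hold for every large \<open>F\<close> without divisibility assumptions. The symbols are therefore
  residues modulo an integer just below the ideal (real) alphabet size, chosen coprime to all differences of
  evaluation points so that Vandermonde systems remain solvable. The files outside the resulting alphabet
  form a vanishing fraction and account for the decoding error.
\<close>

section \<open>Polynomial codes over the integers modulo p\<close>

lemma const_poly_dvd_if_dvd_poly_on:
  fixes f :: "int poly"
  assumes "finite A" and "degree f < card A"
    and "\<And>x. x \<in> A \<Longrightarrow> p dvd poly f x" and "pairwise (\<lambda>x y. coprime p (x - y)) A"
  shows "[:p:] dvd f"
  using assms
proof (induction "degree f" arbitrary: f A)
  case 0
  then obtain a where f: "f = [:a:]"
    using degree_eq_zeroE by metis
  have "A \<noteq> {}" using 0 by auto
  then have "p dvd a" using "0.prems"(3) f by auto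
  then show ?case by (simp add: f)
next
  case (Suc n)
  then obtain x where x: "x \<in> A" by fastforce
  define g where "g = synthetic_div f x"
  have f: "f = [:poly f x:] + [:-x, 1:] * g"
    using synthetic_div_correct'[of x f] by (simp add: g_def add.commute)
  have "[:p:] dvd g"
  proof (rule Suc.hyps(1))
    show "n = degree g" using Suc.hyps(2) by (simp add: g_def degree_synthetic_div)
    show "finite (A - {x})" using Suc.prems by simp
    show "degree g < card (A - {x})"
      using Suc.prems(1,2) Suc.hyps(2) x by (simp add: g_def degree_synthetic_div)
    show "pairwise (\<lambda>x y. coprime p (x - y)) (A - {x})"
      using Suc.prems(4) by (rule pairwise_subset) blast
    show "p dvd poly g y" if y: "y \<in> A - {x}" for y
    proof -
      have "poly f y = poly f x + (y - x) * poly g y"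
        by (subst f) (simp add: algebra_simps)
      moreover have "p dvd poly f y" "p dvd poly f x" using Suc.prems(3) x y by auto
      ultimately have "p dvd (y - x) * poly g y" by (metis dvd_add_right_iff)
      moreover have "coprime p (y - x)" using Suc.prems(4) x y by (auto simp: pairwise_def)
      ultimately show ?thesis by (simp add: coprime_dvd_mult_right_iff)
    qed
  qed
  moreover have "[:p:] dvd [:poly f x:]" using Suc.prems(3) x by simp
  ultimately show ?case by (subst f) (intro dvd_add dvd_mult)
qed

definition poly_eval :: "nat \<Rightarrow> (nat \<Rightarrow> int) \<Rightarrow> int \<Rightarrow> int" where
  "poly_eval m c x = (\<Sum>l<m. c l * x ^ l)"

lemma poly_eval_add: "poly_eval m (\<lambda>l. b l + c l) x = poly_eval m b x + poly_eval m c x"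
  by (simp add: poly_eval_def sum.distrib algebra_simps)

lemma poly_eval_cong_mod:
  assumes "\<And>l. l < m \<Longrightarrow> [b l = c l] (mod p)"
  shows "[poly_eval m b x = poly_eval m c x] (mod p)"
  unfolding poly_eval_def using assms by (intro cong_sum cong_mult cong_refl) auto

lemma poly_eval_append:
  "poly_eval (k + m) (\<lambda>l. if l < k then b l else c (l - k)) x = poly_eval k b x + x ^ k * poly_eval m c x"
proof -
  have "(\<Sum>l<k + m. g l) = (\<Sum>l<k. g l) + (\<Sum>l<m. g (k + l))" for g :: "nat \<Rightarrow> int"
    by (induction m) (auto simp: ac_simps)
  then show ?thesis
    by (simp add: poly_eval_def sum_distrib_left power_add mult.left_commute)
qed

lemma coeffs_cong_if_poly_eval_cong:
  assumes A: "finite A" "m \<le> card A" "pairwise (\<lambda>x y. coprime p (x - y)) A"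
    and eval: "\<And>x. x \<in> A \<Longrightarrow> [poly_eval m b x = poly_eval m c x] (mod p)"
    and l: "l < m"
  shows "[b l = c l] (mod p)"
proof -
  define f where "f = (\<Sum>l<m. monom (b l - c l) l)"
  have "degree f < card A"
  proof -
    have "degree f \<le> m - 1" unfolding f_def
      by (intro degree_sum_le) (auto intro: order.trans[OF degree_monom_le])
    then show ?thesis using l A by simp
  qed
  moreover have "p dvd poly f x" if "x \<in> A" for x
  proof -
    have "poly f x = poly_eval m b x - poly_eval m c x"
      by (simp add: f_def poly_eval_def poly_sum poly_monom algebra_simps sum_subtractf)
    then show ?thesis using eval[OF that] by (simp add: cong_iff_dvd_diff)
  qed
  ultimately have "[:p:] dvd f" using const_poly_dvd_if_dvd_poly_on A(1,3) by blast
  then have "p dvd coeff f l" by (simp add: const_poly_dvd_iff)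
  moreover have "coeff f l = b l - c l"
    using l by (simp add: f_def coeff_sum sum.delta)
  ultimately show ?thesis by (simp add: cong_iff_dvd_diff)
qed

lemma ex_poly_eval_cong:
  fixes p :: int
  assumes p: "0 < p" and A: "finite A" "pairwise (\<lambda>x y. coprime p (x - y)) A"
  shows "\<exists>c. \<forall>x\<in>A. [poly_eval (card A) c x = y x] (mod p)"
proof -
  define eval where "eval c = (\<lambda>x\<in>A. poly_eval (card A) c x mod p)" for c
  define C where "C = {..<card A} \<rightarrow>\<^sub>E {0..<p}"
  define E where "E = A \<rightarrow>\<^sub>E {0..<p}"
  have "inj_on eval C"
  proof (rule inj_onI)
    fix b c assume bc: "b \<in> C" "c \<in> C" "eval b = eval c"
    have "[poly_eval (card A) b x = poly_eval (card A) c x] (mod p)" if "x \<in> A" for x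
      using fun_cong[OF bc(3), of x] that by (simp add: eval_def cong_def)
    then have "[b l = c l] (mod p)" if "l < card A" for l
      using coeffs_cong_if_poly_eval_cong[OF A(1) le_refl A(2)] that by blast
    then have "b l = c l" if "l < card A" for l
      using bc(1,2) that by (intro cong_less_imp_eq_int[of _ p]) (auto simp: C_def PiE_iff)
    then show "b = c" using bc by (intro PiE_ext[of b "{..<card A}"]) (auto simp: C_def)
  qed
  then have "card (eval ` C) = card E"
    using A by (simp add: card_image C_def E_def card_PiE)
  moreover have "eval ` C \<subseteq> E" using p by (auto simp: eval_def E_def)
  moreover have "finite E" using A by (auto simp: E_def intro!: finite_PiE)
  ultimately have "eval ` C = E" by (simp add: card_subset_eq)
  moreover have "(\<lambda>x\<in>A. y x mod p) \<in> E" using p by (auto simp: E_def)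
  ultimately obtain c where c: "eval c = (\<lambda>x\<in>A. y x mod p)" by (metis imageE)
  have "[poly_eval (card A) c x = y x] (mod p)" if "x \<in> A" for x
    using fun_cong[OF c, of x] that by (simp add: eval_def cong_def)
  then show ?thesis by blast
qed

lemma pairwise_coprime_diff_if_cong_1_mod_fact:
  fixes p :: int
  assumes "[p = 1] (mod fact b)"
  shows "pairwise (\<lambda>x y. coprime p (x - y)) (int ` {..<b})"
proof (rule pairwiseI)
  fix x y assume "x \<in> int ` {..<b}" "y \<in> int ` {..<b}" "x \<noteq> y"
  then have "nat \<bar>x - y\<bar> dvd fact b" by (intro dvd_fact) auto
  then have "int (nat \<bar>x - y\<bar>) dvd int (fact b)" by (simp only: int_dvd_int_iff)
  then have "x - y dvd fact b" by simp
  moreover have "coprime p (fact b)"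
    using assms by (metis cong_imp_coprime cong_sym coprime_1_left)
  ultimately show "coprime p (x - y)" by (metis coprime_divisors dvd_refl)
qed

definition ramp_share :: "nat \<Rightarrow> nat \<Rightarrow> (nat \<Rightarrow> int) \<Rightarrow> (nat \<Rightarrow> int) \<Rightarrow> int \<Rightarrow> int" where
  "ramp_share k m key msg x = poly_eval k key x + x ^ k * poly_eval m msg x"

lemma msg_cong_if_ramp_shares_cong:
  assumes A: "finite A" "k + m \<le> card A" "pairwise (\<lambda>x y. coprime p (x - y)) A"
    and shares: "\<And>x. x \<in> A \<Longrightarrow> [ramp_share k m key msg x = ramp_share k m key' msg' x] (mod p)"
    and l: "l < m"
  shows "[msg l = msg' l] (mod p)"
proof -
  let ?coeffs = "\<lambda>key msg l. if l < k then key l else msg (l - k) :: int"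
  have eval: "[poly_eval (k + m) (?coeffs key msg) x = poly_eval (k + m) (?coeffs key' msg') x] (mod p)"
    if "x \<in> A" for x
    using shares[OF that] by (simp only: ramp_share_def poly_eval_append)
  have "k + l < k + m" using l by simp
  from coeffs_cong_if_poly_eval_cong[OF A eval this]
  have "[?coeffs key msg (k + l) = ?coeffs key' msg' (k + l)] (mod p)" .
  then show ?thesis by simp
qed

text \<open>Under a uniform key, \<open>card A\<close> shares are therefore independent of the message.\<close>

lemma ex_key_shift:
  fixes p :: int
  assumes "0 < p" and "finite A" and "pairwise (\<lambda>x y. coprime p (x - y)) A"
  shows "\<exists>\<delta>. \<forall>x\<in>A. \<forall>key.
    [ramp_share (card A) m (\<lambda>l. key l + \<delta> l) msg' x = ramp_share (card A) m key msg x] (mod p)"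
proof -
  obtain \<delta> where \<delta>: "\<And>x. x \<in> A \<Longrightarrow>
      [poly_eval (card A) \<delta> x = x ^ card A * (poly_eval m msg x - poly_eval m msg' x)] (mod p)"
    using ex_poly_eval_cong[OF assms, of "\<lambda>x. x ^ card A * (poly_eval m msg x - poly_eval m msg' x)"]
    by blast
  have "[ramp_share (card A) m (\<lambda>l. key l + \<delta> l) msg' x = ramp_share (card A) m key msg x] (mod p)"
    if "x \<in> A" for x key
  proof -
    have "[poly_eval (card A) key x + poly_eval (card A) \<delta> x + x ^ card A * poly_eval m msg' x =
        poly_eval (card A) key x + x ^ card A * (poly_eval m msg x - poly_eval m msg' x) +
          x ^ card A * poly_eval m msg' x] (mod p)"
      by (intro cong_add cong_refl \<delta> that)
    then show ?thesis by (simp add: ramp_share_def poly_eval_add algebra_simps)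
  qed
  then show ?thesis by blast
qed

lemma ramp_share_cong_mod:
  assumes "\<And>l. l < k \<Longrightarrow> [key l = key' l] (mod p)"
  shows "[ramp_share k m key msg x = ramp_share k m key' msg x] (mod p)"
  unfolding ramp_share_def by (intro cong_add cong_refl poly_eval_cong_mod assms)

section \<open>Entropy and uniform files\<close>

lemma ent_altdef:
  "ent P X = (\<Sum>y\<in>set_pmf (map_pmf X P). - pmf (map_pmf X P) y * log 2 (pmf (map_pmf X P) y))"
  by (simp add: ent_def)

lemma ent_le_if_card_le_powr:
  assumes fin: "finite (set_pmf P)" and A: "finite A" "X ` set_pmf P \<subseteq> A"
    and card: "card A \<le> 2 powr b"
  shows "ent P X \<le> b"
proof -
  define Q where "Q = map_pmf X P"
  have Q: "finite (set_pmf Q)" "set_pmf Q \<subseteq> A" using fin A by (auto simp: Q_def)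
  have pos: "0 < pmf Q y" if "y \<in> set_pmf Q" for y
    using that by (rule pmf_positive)
  have "- log 2 (\<Sum>y\<in>set_pmf Q. pmf Q y *\<^sub>R (1 / pmf Q y))
      \<le> (\<Sum>y\<in>set_pmf Q. pmf Q y * - log 2 (1 / pmf Q y))"
    using Q(1) pos by (intro convex_on_sum[where C = "{0<..}"] minus_log_convex)
      (auto simp: sum_pmf_eq_1 set_pmf_not_empty)
  also have "(\<Sum>y\<in>set_pmf Q. pmf Q y *\<^sub>R (1 / pmf Q y)) = (\<Sum>y\<in>set_pmf Q. 1)"
    using pos by (intro sum.cong) (auto simp: set_pmf_iff)
  also have "(\<Sum>y\<in>set_pmf Q. pmf Q y * - log 2 (1 / pmf Q y)) = - ent P X"
    unfolding ent_altdef Q_def[symmetric] sum_negf[symmetric]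
    using pos by (intro sum.cong) (auto simp: log_divide)
  finally have "ent P X \<le> log 2 (card (set_pmf Q))" by simp
  also have "\<dots> \<le> b"
  proof -
    have "real (card (set_pmf Q)) \<le> 2 powr b" using card card_mono[OF A(1) Q(2)] by linarith
    moreover have "0 < card (set_pmf Q)" using Q(1) by (simp add: card_gt_0_iff set_pmf_not_empty)
    ultimately show ?thesis by (simp add: log_le_iff)
  qed
  finally show ?thesis .
qed

lemma mi_eq_0_if_pair_pmf:
  assumes fin: "finite (set_pmf P)" and indep: "map_pmf (\<lambda>\<omega>. (X \<omega>, Y \<omega>)) P = pair_pmf \<alpha> \<beta>"
  shows "mi P X Y = 0"
proof -
  have X: "map_pmf X P = \<alpha>"
    using arg_cong[OF indep, of "map_pmf fst"] by (simp add: map_fst_pair_pmf pmf.map_comp o_def)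
  have Y: "map_pmf Y P = \<beta>"
    using arg_cong[OF indep, of "map_pmf snd"] by (simp add: map_snd_pair_pmf pmf.map_comp o_def)
  have "finite (set_pmf \<alpha>)" "finite (set_pmf \<beta>)" using fin by (auto simp flip: X Y)
  then have total: "(\<Sum>a\<in>set_pmf \<alpha>. pmf \<alpha> a) = 1" "(\<Sum>b\<in>set_pmf \<beta>. pmf \<beta> b) = 1"
    by (auto intro!: sum_pmf_eq_1)
  have "ent P (\<lambda>\<omega>. (X \<omega>, Y \<omega>)) =
    (\<Sum>(a, b)\<in>set_pmf \<alpha> \<times> set_pmf \<beta>. - (pmf \<alpha> a * pmf \<beta> b) * log 2 (pmf \<alpha> a * pmf \<beta> b))"
    unfolding ent_altdef indep by (simp add: pmf_pair case_prod_unfold)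
      (intro sum.cong refl, metis pmf_pair prod.collapse)
  also have "\<dots> = (\<Sum>(a, b)\<in>set_pmf \<alpha> \<times> set_pmf \<beta>.
      (- pmf \<alpha> a * log 2 (pmf \<alpha> a)) * pmf \<beta> b + pmf \<alpha> a * (- pmf \<beta> b * log 2 (pmf \<beta> b)))"
    by (intro sum.cong refl) (auto simp: log_mult pmf_positive set_pmf_iff algebra_simps)
  also have "\<dots> = (\<Sum>a\<in>set_pmf \<alpha>. - pmf \<alpha> a * log 2 (pmf \<alpha> a)) * (\<Sum>b\<in>set_pmf \<beta>. pmf \<beta> b)
      + (\<Sum>a\<in>set_pmf \<alpha>. pmf \<alpha> a) * (\<Sum>b\<in>set_pmf \<beta>. - pmf \<beta> b * log 2 (pmf \<beta> b))"
    by (simp only: sum.cartesian_product[symmetric] sum.distrib sum_product)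
  also have "\<dots> = ent P X + ent P Y" by (simp only: total ent_altdef X Y mult_1 mult_1_right)
  finally show ?thesis by (simp add: mi_def)
qed

lemma pair_pmf_of_set:
  assumes "finite A" "A \<noteq> {}" "finite B" "B \<noteq> {}"
  shows "pair_pmf (pmf_of_set A) (pmf_of_set B) = pmf_of_set (A \<times> B)"
proof (rule pmf_eqI)
  fix x :: "'a \<times> 'b"
  show "pmf (pair_pmf (pmf_of_set A) (pmf_of_set B)) x = pmf (pmf_of_set (A \<times> B)) x"
    using assms by (cases x) (simp add: pmf_pair card_cartesian_product indicator_def)
qed

definition words :: "nat \<Rightarrow> bool list set" where
  "words F = {w. length w = F}"

lemma finite_words [simp]: "finite (words F)" and card_words: "card (words F) = 2 ^ F"
  using finite_lists_length_eq[of "UNIV :: bool set" F] card_lists_length_eq[of "UNIV :: bool set" F]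
  by (simp_all add: words_def)

lemma words_nonempty [simp]: "words F \<noteq> {}"
  unfolding words_def using Ex_list_of_length by auto

lemma finite_files [simp]: "finite (files D F)"
proof -
  have "files D F = {ws. set ws \<subseteq> words F \<and> length ws = D}" by (auto simp: files_def words_def)
  then show ?thesis using finite_lists_length_eq[OF finite_words] by simp
qed

lemma files_nonempty [simp]: "files D F \<noteq> {}"
proof -
  have "replicate D (replicate F True) \<in> files D F" by (auto simp: files_def)
  then show ?thesis by blast
qed

lemma length_files: "ws \<in> files D F \<Longrightarrow> length ws = D"
  by (simp add: files_def)

lemma nth_file_in_words: "ws \<in> files D F \<Longrightarrow> k < D \<Longrightarrow> ws ! k \<in> words F"
  by (auto simp: files_def words_def)

lemma update_in_files: "ws \<in> files D F \<Longrightarrow> w \<in> words F \<Longrightarrow> ws[k := w] \<in> files D F"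
  by (auto simp: files_def words_def dest!: subsetD[OF set_update_subset_insert])

lemma update_uniform_files:
  assumes k: "k < D"
  shows "map_pmf (\<lambda>(ws, w). ws[k := w]) (pair_pmf (pmf_of_set (files D F)) (pmf_of_set (words F))) =
    pmf_of_set (files D F)"
proof -
  let ?S = "files D F \<times> words F"
  let ?P = "pair_pmf (pmf_of_set (files D F)) (pmf_of_set (words F))"
  define swap where "swap = (\<lambda>(ws :: bool list list, w). (ws[k := w], ws ! k))"
  have "bij_betw swap ?S ?S"
    by (rule bij_betw_byWitness[where f' = swap])
      (use k in \<open>auto simp: swap_def update_in_files nth_file_in_words length_files\<close>)
  moreover have "?S \<noteq> {}" "finite ?S"
    by (simp_all add: Sigma_empty_iff)
  ultimately have "map_pmf swap (pmf_of_set ?S) = pmf_of_set ?S"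
    by (rule map_pmf_of_set_bij_betw)
  then have swap: "map_pmf swap ?P = ?P"
    by (simp add: pair_pmf_of_set)
  have "map_pmf (\<lambda>(ws, w). ws[k := w]) ?P = map_pmf fst (map_pmf swap ?P)"
    by (simp add: swap_def pmf.map_comp o_def case_prod_unfold)
  then show ?thesis by (simp only: swap map_fst_pair_pmf)
qed

lemma nth_uniform_files:
  assumes k: "k < D"
  shows "map_pmf (\<lambda>ws. ws ! k) (pmf_of_set (files D F)) = pmf_of_set (words F)"
proof -
  let ?P = "pair_pmf (pmf_of_set (files D F)) (pmf_of_set (words F))"
  have "map_pmf (\<lambda>ws. ws ! k) (pmf_of_set (files D F)) = map_pmf (\<lambda>(ws, w). ws[k := w] ! k) ?P"
    by (subst update_uniform_files[OF k, symmetric]) (simp add: pmf.map_comp o_def case_prod_unfold)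
  also have "\<dots> = map_pmf snd ?P"
    using k by (intro map_pmf_cong refl) (auto simp: length_files)
  finally show ?thesis by (simp only: map_snd_pair_pmf)
qed

lemma nths_Compl_update: "nths (ws[k := w]) (- {k}) = nths ws (- {k})"
proof (induction ws arbitrary: k)
  case (Cons x ws)
  have "{j. Suc j \<in> - {Suc k}} = - {k}" for k by auto
  with Cons show ?case by (cases k) (simp_all add: nths_Cons)
qed simp

lemma mi_other_files_eq_0:
  assumes k: "k < D" and fin: "finite (set_pmf \<rho>)"
    and view: "\<And>ws. ws \<in> files D F \<Longrightarrow> map_pmf (view ws) \<rho> = \<kappa> (ws ! k)"
  shows "mi (pair_pmf (pmf_of_set (files D F)) \<rho>) (\<lambda>(ws, u). nths ws (- {k})) (\<lambda>(ws, u). view ws u) = 0"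
proof (rule mi_eq_0_if_pair_pmf)
  let ?U = "pmf_of_set (files D F)"
  let ?W = "pmf_of_set (words F)"
  let ?other = "\<lambda>ws :: bool list list. nths ws (- {k})"
  show "finite (set_pmf (pair_pmf ?U \<rho>))"
    using fin by simp
  have "map_pmf (\<lambda>\<omega>. (case \<omega> of (ws, u) \<Rightarrow> ?other ws, case \<omega> of (ws, u) \<Rightarrow> view ws u)) (pair_pmf ?U \<rho>)
      = bind_pmf ?U (\<lambda>ws. map_pmf (Pair (?other ws)) (map_pmf (view ws) \<rho>))"
    by (simp add: pair_pmf_def map_bind_pmf map_pmf_def bind_assoc_pmf bind_return_pmf)
  also have "\<dots> = bind_pmf ?U (\<lambda>ws. map_pmf (Pair (?other ws)) (\<kappa> (ws ! k)))"
    by (intro bind_pmf_cong refl arg_cong[where f = "map_pmf _"] view) simp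
  also have "\<dots> = bind_pmf (map_pmf (\<lambda>(ws, w). ws[k := w]) (pair_pmf ?U ?W))
      (\<lambda>ws. map_pmf (Pair (?other ws)) (\<kappa> (ws ! k)))"
    by (simp only: update_uniform_files[OF k])
  also have "\<dots> = bind_pmf ?U (\<lambda>ws. bind_pmf ?W (\<lambda>w.
      map_pmf (Pair (?other ws)) (\<kappa> (ws[k := w] ! k))))"
    by (simp add: pair_pmf_def bind_map_pmf bind_assoc_pmf bind_return_pmf nths_Compl_update)
  also have "\<dots> = bind_pmf ?U (\<lambda>ws. bind_pmf ?W (\<lambda>w. map_pmf (Pair (?other ws)) (\<kappa> w)))"
    using k by (intro bind_pmf_cong refl) (simp add: length_files)
  also have "\<dots> = pair_pmf (map_pmf ?other ?U) (bind_pmf ?W \<kappa>)"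
    by (simp add: pair_pmf_def map_pmf_def bind_assoc_pmf bind_return_pmf)
  finally show "map_pmf (\<lambda>\<omega>. (case \<omega> of (ws, u) \<Rightarrow> ?other ws, case \<omega> of (ws, u) \<Rightarrow> view ws u))
      (pair_pmf ?U \<rho>) = pair_pmf (map_pmf ?other ?U) (bind_pmf ?W \<kappa>)" .
qed

lemma prob_file_notin:
  fixes \<rho> :: "'u pmf"
  assumes k: "k < D" and G: "G \<subseteq> words F"
  shows "measure_pmf.prob (pair_pmf (pmf_of_set (files D F)) \<rho>) {(ws, u). ws ! k \<notin> G} = 1 - card G / 2 ^ F"
proof -
  let ?P = "pair_pmf (pmf_of_set (files D F)) \<rho>"
  have "{(ws, u :: 'u). ws ! k \<notin> G} = fst -` (\<lambda>ws. ws ! k) -` (- G)" by auto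
  then have "measure_pmf.prob ?P {(ws, u). ws ! k \<notin> G} =
      measure_pmf.prob (map_pmf (\<lambda>ws. ws ! k) (map_pmf fst ?P)) (- G)"
    by (simp only: measure_map_pmf)
  also have "\<dots> = measure_pmf.prob (pmf_of_set (words F)) (- G)"
    by (simp only: map_fst_pair_pmf nth_uniform_files[OF k])
  also have "\<dots> = 1 - measure_pmf.prob (pmf_of_set (words F)) G"
    using measure_pmf.prob_compl[of G "pmf_of_set (words F)"] by (simp add: Compl_eq_Diff_UNIV)
  also have "measure_pmf.prob (pmf_of_set (words F)) G = card G / 2 ^ F"
    using G by (simp add: measure_pmf_of_set[OF words_nonempty finite_words] Int_absorb1 card_words)
  finally show ?thesis .
qed

section \<open>Secure codes over arbitrary alphabets\<close>

definition user_view ::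
  "(nat \<Rightarrow> 'f \<Rightarrow> 'u \<Rightarrow> 'v) \<Rightarrow> (nat set \<Rightarrow> 'f \<Rightarrow> 'u \<Rightarrow> 'z) \<Rightarrow> (nat \<Rightarrow> (nat set \<Rightarrow> nat) \<Rightarrow> 'f \<Rightarrow> 'u \<Rightarrow> 'x) \<Rightarrow>
    (nat \<Rightarrow> (nat set \<Rightarrow> nat) \<Rightarrow> nat set \<Rightarrow> 'x \<Rightarrow> 'v \<Rightarrow> 'y) \<Rightarrow>
    (nat set \<Rightarrow> nat) \<Rightarrow> nat set \<Rightarrow> 'f \<Rightarrow> 'u \<Rightarrow> 'z \<times> (nat \<Rightarrow> 'y)" where
  "user_view V Z X Y d S f u = (Z S f u, \<lambda>j\<in>S. Y j d S (X j d f u) (V j f u))"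

lemma relay_less: "S \<in> users h r \<Longrightarrow> j \<in> S \<Longrightarrow> j < h"
  by (auto simp: users_def)

locale secure_scheme =
  fixes h r D :: nat and A :: "'a set" and \<rho> :: "'u pmf"
    and V :: "nat \<Rightarrow> (nat \<Rightarrow> 'a) \<Rightarrow> 'u \<Rightarrow> 'v"
    and Z :: "nat set \<Rightarrow> (nat \<Rightarrow> 'a) \<Rightarrow> 'u \<Rightarrow> 'z"
    and X :: "nat \<Rightarrow> (nat set \<Rightarrow> nat) \<Rightarrow> (nat \<Rightarrow> 'a) \<Rightarrow> 'u \<Rightarrow> 'x"
    and Y :: "nat \<Rightarrow> (nat set \<Rightarrow> nat) \<Rightarrow> nat set \<Rightarrow> 'x \<Rightarrow> 'v \<Rightarrow> 'y"
    and Vs :: "nat \<Rightarrow> 'v set" and Zs :: "nat set \<Rightarrow> 'z set"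
    and Xs :: "nat \<Rightarrow> 'x set" and Ys :: "nat \<Rightarrow> nat set \<Rightarrow> 'y set"
  assumes finite_alphabet: "finite A" and alphabet_nonempty: "A \<noteq> {}"
    and finite_randomness: "finite (set_pmf \<rho>)"
    and finite_relay_caches: "j < h \<Longrightarrow> finite (Vs j)"
    and finite_user_caches: "S \<in> users h r \<Longrightarrow> finite (Zs S)"
    and finite_server_signals: "j < h \<Longrightarrow> finite (Xs j)"
    and finite_relay_signals: "S \<in> users h r \<Longrightarrow> j \<in> S \<Longrightarrow> finite (Ys j S)"
    and relay_cache_in: "j < h \<Longrightarrow> f \<in> {..<D} \<rightarrow> A \<Longrightarrow> u \<in> set_pmf \<rho> \<Longrightarrow> V j f u \<in> Vs j"
    and user_cache_in: "S \<in> users h r \<Longrightarrow> f \<in> {..<D} \<rightarrow> A \<Longrightarrow> u \<in> set_pmf \<rho> \<Longrightarrow> Z S f u \<in> Zs S"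
    and server_signal_in:
      "j < h \<Longrightarrow> d \<in> demands h r D \<Longrightarrow> f \<in> {..<D} \<rightarrow> A \<Longrightarrow> u \<in> set_pmf \<rho> \<Longrightarrow> X j d f u \<in> Xs j"
    and relay_signal_in:
      "S \<in> users h r \<Longrightarrow> j \<in> S \<Longrightarrow> d \<in> demands h r D \<Longrightarrow> f \<in> {..<D} \<rightarrow> A \<Longrightarrow> u \<in> set_pmf \<rho> \<Longrightarrow>
        Y j d S (X j d f u) (V j f u) \<in> Ys j S"
    and decodable:
      "S \<in> users h r \<Longrightarrow> d \<in> demands h r D \<Longrightarrow> f \<in> {..<D} \<rightarrow> A \<Longrightarrow> f' \<in> {..<D} \<rightarrow> A \<Longrightarrow>
        u \<in> set_pmf \<rho> \<Longrightarrow> u' \<in> set_pmf \<rho> \<Longrightarrow> user_view V Z X Y d S f u = user_view V Z X Y d S f' u' \<Longrightarrow>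
        f (d S) = f' (d S)"
    and secure:
      "S \<in> users h r \<Longrightarrow> d \<in> demands h r D \<Longrightarrow> f \<in> {..<D} \<rightarrow> A \<Longrightarrow> f' \<in> {..<D} \<rightarrow> A \<Longrightarrow>
        f (d S) = f' (d S) \<Longrightarrow>
        map_pmf (user_view V Z X Y d S f) \<rho> = map_pmf (user_view V Z X Y d S f') \<rho>"

text \<open>HOL cannot quantify over the types of the alphabets, so initial segments of the naturals stand for all
  finite alphabets.\<close>

definition secure_code :: "nat \<Rightarrow> nat \<Rightarrow> nat \<Rightarrow> nat \<Rightarrow> nat \<Rightarrow> nat \<Rightarrow> nat \<Rightarrow> nat \<Rightarrow> bool" where
  "secure_code h r D a v z x y \<longleftrightarrow>
    (\<exists>(\<rho> :: nat pmf) (V :: nat \<Rightarrow> (nat \<Rightarrow> nat) \<Rightarrow> nat \<Rightarrow> nat) Z X Y. secure_scheme h r D {..<a} \<rho> V Z X Y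
      (\<lambda>_. {..<v}) (\<lambda>_. {..<z}) (\<lambda>_. {..<x}) (\<lambda>_ _. {..<y}))"

lemma to_nat_on_less_card: "finite S \<Longrightarrow> s \<in> S \<Longrightarrow> to_nat_on S s < card S"
  using bij_betw_apply[OF to_nat_on_finite, of S s] by simp

lemma to_nat_on_from_nat_into_less: "finite S \<Longrightarrow> n < card S \<Longrightarrow> to_nat_on S (from_nat_into S n) = n"
  by (intro to_nat_on_from_nat_into) (simp add: bij_betw_imp_surj_on[OF to_nat_on_finite])

context secure_scheme
begin

abbreviation "view \<equiv> user_view V Z X Y"

lemma view_in:
  assumes "S \<in> users h r" "d \<in> demands h r D" "f \<in> {..<D} \<rightarrow> A" "u \<in> set_pmf \<rho>"
  shows "view d S f u \<in> Zs S \<times> (\<Pi>\<^sub>E j\<in>S. Ys j S)"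
  unfolding user_view_def using assms
  by (intro SigmaI user_cache_in restrict_PiE_iff[THEN iffD2] ballI relay_signal_in)

definition decode :: "(nat set \<Rightarrow> nat) \<Rightarrow> nat set \<Rightarrow> 'z \<times> (nat \<Rightarrow> 'y) \<Rightarrow> 'a" where
  "decode d S w = (SOME n. \<exists>f u. f \<in> {..<D} \<rightarrow> A \<and> u \<in> set_pmf \<rho> \<and> w = view d S f u \<and> n = f (d S))"

lemma decode_view:
  assumes S: "S \<in> users h r" and d: "d \<in> demands h r D" and f: "f \<in> {..<D} \<rightarrow> A" and u: "u \<in> set_pmf \<rho>"
  shows "decode d S (view d S f u) = f (d S)"
  unfolding decode_def
proof (rule some_equality)
  show "\<exists>f' u'. f' \<in> {..<D} \<rightarrow> A \<and> u' \<in> set_pmf \<rho> \<and> view d S f u = view d S f' u' \<and> f (d S) = f' (d S)"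
    using f u by blast
qed (use decodable[OF S d _ f _ u] in metis)

definition symbols :: "(nat \<Rightarrow> nat) \<Rightarrow> nat \<Rightarrow> 'a" where
  "symbols f n = from_nat_into A (f n)"

definition random_value :: "nat \<Rightarrow> 'u" where
  "random_value = from_nat_into (set_pmf \<rho>)"

definition enum_V :: "nat \<Rightarrow> (nat \<Rightarrow> nat) \<Rightarrow> nat \<Rightarrow> nat" where
  "enum_V j f u = to_nat_on (Vs j) (V j (symbols f) (random_value u))"

definition enum_Z :: "nat set \<Rightarrow> (nat \<Rightarrow> nat) \<Rightarrow> nat \<Rightarrow> nat" where
  "enum_Z S f u = to_nat_on (Zs S) (Z S (symbols f) (random_value u))"

definition enum_X :: "nat \<Rightarrow> (nat set \<Rightarrow> nat) \<Rightarrow> (nat \<Rightarrow> nat) \<Rightarrow> nat \<Rightarrow> nat" where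
  "enum_X j d f u = to_nat_on (Xs j) (X j d (symbols f) (random_value u))"

definition enum_Y :: "nat \<Rightarrow> (nat set \<Rightarrow> nat) \<Rightarrow> nat set \<Rightarrow> nat \<Rightarrow> nat \<Rightarrow> nat" where
  "enum_Y j d S x v = to_nat_on (Ys j S) (Y j d S (from_nat_into (Xs j) x) (from_nat_into (Vs j) v))"

definition enum_view :: "nat set \<Rightarrow> 'z \<times> (nat \<Rightarrow> 'y) \<Rightarrow> nat \<times> (nat \<Rightarrow> nat)" where
  "enum_view S = map_prod (to_nat_on (Zs S)) (\<lambda>y. \<lambda>j\<in>S. to_nat_on (Ys j S) (y j))"

abbreviation "enum_user_view \<equiv> user_view enum_V enum_Z enum_X enum_Y"

lemma symbols_in: "symbols f \<in> {..<D} \<rightarrow> A"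
  using from_nat_into[OF alphabet_nonempty] by (simp add: symbols_def)

lemma random_value_in: "random_value u \<in> set_pmf \<rho>"
  unfolding random_value_def by (intro from_nat_into set_pmf_not_empty)

lemma enum_V_less: "j < h \<Longrightarrow> enum_V j f u < card (Vs j)"
  unfolding enum_V_def
  by (intro to_nat_on_less_card finite_relay_caches relay_cache_in symbols_in random_value_in)

lemma enum_Z_less: "S \<in> users h r \<Longrightarrow> enum_Z S f u < card (Zs S)"
  unfolding enum_Z_def
  by (intro to_nat_on_less_card finite_user_caches user_cache_in symbols_in random_value_in)

lemma enum_X_less: "j < h \<Longrightarrow> d \<in> demands h r D \<Longrightarrow> enum_X j d f u < card (Xs j)"
  unfolding enum_X_def
  by (intro to_nat_on_less_card finite_server_signals server_signal_in symbols_in random_value_in)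

lemma enum_Y_enum_X_enum_V:
  assumes "S \<in> users h r" "j \<in> S" "d \<in> demands h r D"
  shows "enum_Y j d S (enum_X j d f u) (enum_V j f u) =
    to_nat_on (Ys j S) (Y j d S (X j d (symbols f) (random_value u)) (V j (symbols f) (random_value u)))"
proof -
  have j: "j < h" using assms by (auto intro: relay_less)
  note random = symbols_in[of f] random_value_in[of u]
  have "from_nat_into (Xs j) (enum_X j d f u) = X j d (symbols f) (random_value u)"
    unfolding enum_X_def using server_signal_in[OF j assms(3) random] finite_server_signals[OF j]
    by (intro from_nat_into_to_nat_on countable_finite)
  moreover have "from_nat_into (Vs j) (enum_V j f u) = V j (symbols f) (random_value u)"
    unfolding enum_V_def using relay_cache_in[OF j random] finite_relay_caches[OF j]
    by (intro from_nat_into_to_nat_on countable_finite)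
  ultimately show ?thesis by (simp only: enum_Y_def)
qed

lemma enum_Y_less:
  assumes "S \<in> users h r" "j \<in> S" "d \<in> demands h r D"
  shows "enum_Y j d S (enum_X j d f u) (enum_V j f u) < card (Ys j S)"
  unfolding enum_Y_enum_X_enum_V[OF assms] using assms
  by (intro to_nat_on_less_card finite_relay_signals relay_signal_in symbols_in random_value_in)

lemma user_view_enum:
  assumes "S \<in> users h r" "d \<in> demands h r D"
  shows "enum_user_view d S f u = enum_view S (view d S (symbols f) (random_value u))"
  unfolding user_view_def enum_view_def enum_Z_def map_prod_simp prod.inject
  by (intro conjI refl restrict_ext) (simp add: enum_Y_enum_X_enum_V[OF assms(1) _ assms(2)])

lemma inj_on_enum_view:
  assumes "S \<in> users h r"
  shows "inj_on (enum_view S) (Zs S \<times> (\<Pi>\<^sub>E j\<in>S. Ys j S))"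
proof -
  have "inj_on (\<lambda>y. \<lambda>j\<in>S. to_nat_on (Ys j S) (y j)) (\<Pi>\<^sub>E j\<in>S. Ys j S)"
  proof (rule inj_onI)
    fix y y' assume y: "y \<in> (\<Pi>\<^sub>E j\<in>S. Ys j S)" "y' \<in> (\<Pi>\<^sub>E j\<in>S. Ys j S)"
      and eq: "(\<lambda>j\<in>S. to_nat_on (Ys j S) (y j)) = (\<lambda>j\<in>S. to_nat_on (Ys j S) (y' j))"
    have "y j = y' j" if j: "j \<in> S" for j
    proof -
      have "y j \<in> Ys j S" "y' j \<in> Ys j S" using y j by auto
      then show ?thesis
        using fun_cong[OF eq, of j] j finite_relay_signals[OF assms j] by (simp add: countable_finite)
    qed
    then show "y = y'" by (rule PiE_ext[OF y])
  qed
  moreover have "inj_on (to_nat_on (Zs S)) (Zs S)"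
    using finite_user_caches[OF assms] by (intro inj_on_to_nat_on countable_finite)
  ultimately show ?thesis unfolding enum_view_def by (intro map_prod_inj_on)
qed

lemma enum_decodable:
  assumes S: "S \<in> users h r" and d: "d \<in> demands h r D"
    and f: "f \<in> {..<D} \<rightarrow> {..<card A}" "f' \<in> {..<D} \<rightarrow> {..<card A}"
    and eq: "enum_user_view d S f u = enum_user_view d S f' u'"
  shows "f (d S) = f' (d S)"
proof -
  have "view d S (symbols f) (random_value u) = view d S (symbols f') (random_value u')"
    using inj_onD[OF inj_on_enum_view[OF S] eq[unfolded user_view_enum[OF S d]]]
      view_in[OF S d symbols_in random_value_in] by blast
  then have "symbols f (d S) = symbols f' (d S)"
    by (rule decodable[OF S d symbols_in symbols_in random_value_in random_value_in])
  moreover have "f (d S) < card A" "f' (d S) < card A" using f d S by (auto simp: demands_def)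
  ultimately show ?thesis unfolding symbols_def by (metis to_nat_on_from_nat_into_less finite_alphabet)
qed

lemma enum_secure:
  assumes S: "S \<in> users h r" and d: "d \<in> demands h r D" and eq: "f (d S) = f' (d S)"
  shows "map_pmf (enum_user_view d S f) (map_pmf (to_nat_on (set_pmf \<rho>)) \<rho>) =
    map_pmf (enum_user_view d S f') (map_pmf (to_nat_on (set_pmf \<rho>)) \<rho>)"
proof -
  have "map_pmf (enum_user_view d S f) (map_pmf (to_nat_on (set_pmf \<rho>)) \<rho>) =
      map_pmf (enum_view S) (map_pmf (view d S (symbols f)) \<rho>)" for f
    unfolding pmf.map_comp o_def using finite_randomness
    by (intro map_pmf_cong refl) (simp add: user_view_enum[OF S d] random_value_def countable_finite)
  then show ?thesis using secure[OF S d symbols_in symbols_in, of f f'] eq by (simp add: symbols_def)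
qed

lemma secure_code:
  assumes "\<And>j. j < h \<Longrightarrow> card (Vs j) \<le> v" and "\<And>S. S \<in> users h r \<Longrightarrow> card (Zs S) \<le> z"
    and "\<And>j. j < h \<Longrightarrow> card (Xs j) \<le> x"
    and "\<And>S j. S \<in> users h r \<Longrightarrow> j \<in> S \<Longrightarrow> card (Ys j S) \<le> y"
  shows "secure_code h r D (card A) v z x y"
proof -
  have "secure_scheme h r D {..<card A} (map_pmf (to_nat_on (set_pmf \<rho>)) \<rho>) enum_V enum_Z enum_X enum_Y
      (\<lambda>_. {..<v}) (\<lambda>_. {..<z}) (\<lambda>_. {..<x}) (\<lambda>_ _. {..<y})"
  proof
    show "{..<card A} \<noteq> {}" using finite_alphabet alphabet_nonempty by (simp add: lessThan_empty_iff)
    show "finite (set_pmf (map_pmf (to_nat_on (set_pmf \<rho>)) \<rho>))" using finite_randomness by simp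
    show "enum_V j f u \<in> {..<v}" if "j < h" for j f u
      using less_le_trans[OF enum_V_less assms(1)] that by simp
    show "enum_Z S f u \<in> {..<z}" if "S \<in> users h r" for S f u
      using less_le_trans[OF enum_Z_less assms(2)] that by simp
    show "enum_X j d f u \<in> {..<x}" if "j < h" "d \<in> demands h r D" for j d f u
      using less_le_trans[OF enum_X_less assms(3)] that by simp
    show "enum_Y j d S (enum_X j d f u) (enum_V j f u) \<in> {..<y}"
      if "S \<in> users h r" "j \<in> S" "d \<in> demands h r D" for S j d f u
      using less_le_trans[OF enum_Y_less assms(4)] that by simp
  qed (assumption | rule finite_lessThan enum_decodable enum_secure)+
  then show ?thesis unfolding secure_code_def by blast
qed

end

locale secure_scheme_pair =
  left: secure_scheme h r D A \<rho> V Z X Y Vs Zs Xs Ys +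
  right: secure_scheme h r D A' \<rho>' V' Z' X' Y' Vs' Zs' Xs' Ys'
  for h r D and A :: "'a set" and \<rho> :: "'u pmf"
    and V :: "nat \<Rightarrow> (nat \<Rightarrow> 'a) \<Rightarrow> 'u \<Rightarrow> 'v" and Z :: "nat set \<Rightarrow> (nat \<Rightarrow> 'a) \<Rightarrow> 'u \<Rightarrow> 'z"
    and X :: "nat \<Rightarrow> (nat set \<Rightarrow> nat) \<Rightarrow> (nat \<Rightarrow> 'a) \<Rightarrow> 'u \<Rightarrow> 'x"
    and Y :: "nat \<Rightarrow> (nat set \<Rightarrow> nat) \<Rightarrow> nat set \<Rightarrow> 'x \<Rightarrow> 'v \<Rightarrow> 'y" and Vs Zs Xs Ys
    and A' :: "'b set" and \<rho>' :: "'t pmf"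
    and V' :: "nat \<Rightarrow> (nat \<Rightarrow> 'b) \<Rightarrow> 't \<Rightarrow> 'w" and Z' :: "nat set \<Rightarrow> (nat \<Rightarrow> 'b) \<Rightarrow> 't \<Rightarrow> 'q"
    and X' :: "nat \<Rightarrow> (nat set \<Rightarrow> nat) \<Rightarrow> (nat \<Rightarrow> 'b) \<Rightarrow> 't \<Rightarrow> 'm"
    and Y' :: "nat \<Rightarrow> (nat set \<Rightarrow> nat) \<Rightarrow> nat set \<Rightarrow> 'm \<Rightarrow> 'w \<Rightarrow> 'n" and Vs' Zs' Xs' Ys'
begin

definition pair_V :: "nat \<Rightarrow> (nat \<Rightarrow> 'a \<times> 'b) \<Rightarrow> 'u \<times> 't \<Rightarrow> 'v \<times> 'w" where
  "pair_V j f u = (V j (fst \<circ> f) (fst u), V' j (snd \<circ> f) (snd u))"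

definition pair_Z :: "nat set \<Rightarrow> (nat \<Rightarrow> 'a \<times> 'b) \<Rightarrow> 'u \<times> 't \<Rightarrow> 'z \<times> 'q" where
  "pair_Z S f u = (Z S (fst \<circ> f) (fst u), Z' S (snd \<circ> f) (snd u))"

definition pair_X :: "nat \<Rightarrow> (nat set \<Rightarrow> nat) \<Rightarrow> (nat \<Rightarrow> 'a \<times> 'b) \<Rightarrow> 'u \<times> 't \<Rightarrow> 'x \<times> 'm" where
  "pair_X j d f u = (X j d (fst \<circ> f) (fst u), X' j d (snd \<circ> f) (snd u))"

definition pair_Y :: "nat \<Rightarrow> (nat set \<Rightarrow> nat) \<Rightarrow> nat set \<Rightarrow> 'x \<times> 'm \<Rightarrow> 'v \<times> 'w \<Rightarrow> 'y \<times> 'n" where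
  "pair_Y j d S x v = (Y j d S (fst x) (fst v), Y' j d S (snd x) (snd v))"

definition merge_views ::
  "nat set \<Rightarrow> ('z \<times> (nat \<Rightarrow> 'y)) \<times> ('q \<times> (nat \<Rightarrow> 'n)) \<Rightarrow> ('z \<times> 'q) \<times> (nat \<Rightarrow> 'y \<times> 'n)" where
  "merge_views S = (\<lambda>((z, y), (z', y')). ((z, z'), \<lambda>j\<in>S. (y j, y' j)))"

abbreviation "pair_user_view \<equiv> user_view pair_V pair_Z pair_X pair_Y"

lemma user_view_pair:
  "pair_user_view d S f u =
    merge_views S (left.view d S (fst \<circ> f) (fst u), right.view d S (snd \<circ> f) (snd u))"
  by (auto simp: user_view_def merge_views_def pair_V_def pair_Z_def pair_X_def pair_Y_def)

lemma user_views_eqD: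
  assumes "pair_user_view d S f u = pair_user_view d S f' u'"
  shows "left.view d S (fst \<circ> f) (fst u) = left.view d S (fst \<circ> f') (fst u')"
    and "right.view d S (snd \<circ> f) (snd u) = right.view d S (snd \<circ> f') (snd u')"
  using assms unfolding user_view_def pair_V_def pair_Z_def pair_X_def pair_Y_def
  by (auto simp: fun_eq_iff restrict_def split: if_splits)

lemma components_in:
  assumes "f \<in> {..<D} \<rightarrow> A \<times> A'"
  shows "fst \<circ> f \<in> {..<D} \<rightarrow> A" and "snd \<circ> f \<in> {..<D} \<rightarrow> A'"
  using assms by (auto simp: Pi_iff mem_Times_iff)

sublocale pair: secure_scheme h r D "A \<times> A'" "pair_pmf \<rho> \<rho>'" pair_V pair_Z pair_X pair_Y
  "\<lambda>j. Vs j \<times> Vs' j" "\<lambda>S. Zs S \<times> Zs' S" "\<lambda>j. Xs j \<times> Xs' j" "\<lambda>j S. Ys j S \<times> Ys' j S"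
proof
  show "A \<times> A' \<noteq> {}" using left.alphabet_nonempty right.alphabet_nonempty by blast
next
  fix S d f f' u u'
  assume S: "S \<in> users h r" and d: "d \<in> demands h r D"
    and f: "f \<in> {..<D} \<rightarrow> A \<times> A'" "f' \<in> {..<D} \<rightarrow> A \<times> A'"
    and u: "u \<in> set_pmf (pair_pmf \<rho> \<rho>')" "u' \<in> set_pmf (pair_pmf \<rho> \<rho>')"
    and eq: "pair_user_view d S f u = pair_user_view d S f' u'"
  show "f (d S) = f' (d S)"
  proof (rule prod_eqI)
    show "fst (f (d S)) = fst (f' (d S))"
      using left.decodable[OF S d components_in(1)[OF f(1)] components_in(1)[OF f(2)] _ _
          user_views_eqD(1)[OF eq]] u by auto
    show "snd (f (d S)) = snd (f' (d S))"
      using right.decodable[OF S d components_in(2)[OF f(1)] components_in(2)[OF f(2)] _ _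
          user_views_eqD(2)[OF eq]] u by auto
  qed
next
  fix S d f f'
  assume S: "S \<in> users h r" and d: "d \<in> demands h r D"
    and f: "f \<in> {..<D} \<rightarrow> A \<times> A'" "f' \<in> {..<D} \<rightarrow> A \<times> A'" and eq: "f (d S) = f' (d S)"
  have "map_pmf (pair_user_view d S f) (pair_pmf \<rho> \<rho>') = map_pmf (merge_views S)
      (pair_pmf (map_pmf (left.view d S (fst \<circ> f)) \<rho>) (map_pmf (right.view d S (snd \<circ> f)) \<rho>'))" for f
    by (simp add: map_pair[symmetric] pmf.map_comp o_def case_prod_unfold user_view_pair[abs_def])
  then show "map_pmf (pair_user_view d S f) (pair_pmf \<rho> \<rho>') =
      map_pmf (pair_user_view d S f') (pair_pmf \<rho> \<rho>')"
    using left.secure[OF S d components_in(1)[OF f(1)] components_in(1)[OF f(2)]]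
      right.secure[OF S d components_in(2)[OF f(1)] components_in(2)[OF f(2)]] eq by simp
qed (use components_in in \<open>auto simp: pair_V_def pair_Z_def pair_X_def pair_Y_def
    left.finite_alphabet right.finite_alphabet left.finite_randomness right.finite_randomness
    left.finite_relay_caches right.finite_relay_caches left.finite_user_caches right.finite_user_caches
    left.finite_server_signals right.finite_server_signals
    left.finite_relay_signals right.finite_relay_signals
    left.relay_cache_in right.relay_cache_in left.user_cache_in right.user_cache_in
    left.server_signal_in right.server_signal_in left.relay_signal_in right.relay_signal_in\<close>)

end

lemma secure_code_mult:
  assumes "secure_code h r D a v z x y" and "secure_code h r D a' v' z' x' y'"
  shows "secure_code h r D (a * a') (v * v') (z * z') (x * x') (y * y')"
proof -
  from assms obtain \<rho> \<rho>' :: "nat pmf" and V V' :: "nat \<Rightarrow> (nat \<Rightarrow> nat) \<Rightarrow> nat \<Rightarrow> nat" and Z Z' X X' Y Y' where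
    "secure_scheme h r D {..<a} \<rho> V Z X Y (\<lambda>_. {..<v}) (\<lambda>_. {..<z}) (\<lambda>_. {..<x}) (\<lambda>_ _. {..<y})"
    "secure_scheme h r D {..<a'} \<rho>' V' Z' X' Y' (\<lambda>_. {..<v'}) (\<lambda>_. {..<z'}) (\<lambda>_. {..<x'}) (\<lambda>_ _. {..<y'})"
    unfolding secure_code_def by blast
  then interpret secure_scheme_pair h r D
    "{..<a}" \<rho> V Z X Y "\<lambda>_. {..<v}" "\<lambda>_. {..<z}" "\<lambda>_. {..<x}" "\<lambda>_ _. {..<y}"
    "{..<a'}" \<rho>' V' Z' X' Y' "\<lambda>_. {..<v'}" "\<lambda>_. {..<z'}" "\<lambda>_. {..<x'}" "\<lambda>_ _. {..<y'}"
    by (rule secure_scheme_pair.intro)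
  show ?thesis
    using pair.secure_code[of "v * v'" "z * z'" "x * x'" "y * y'"] by (simp add: card_cartesian_product)
qed

section \<open>From codes to bits\<close>

definition word :: "nat \<Rightarrow> nat \<Rightarrow> bool list" where
  "word L = from_nat_into (words L)"

definition word_index :: "nat \<Rightarrow> bool list \<Rightarrow> nat" where
  "word_index L = to_nat_on (words L)"

lemma length_word [simp]: "length (word L n) = L"
  using from_nat_into[OF words_nonempty, of L n] by (simp add: word_def words_def)

lemma word_index_word: "n < 2 ^ L \<Longrightarrow> word_index L (word L n) = n"
  by (simp only: word_def word_index_def to_nat_on_from_nat_into_less finite_words card_words)

lemma word_word_index: "w \<in> words L \<Longrightarrow> word L (word_index L w) = w"
  by (simp only: word_def word_index_def from_nat_into_to_nat_on countable_finite finite_words)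

lemma card_encodable_words:
  assumes "a \<le> 2 ^ F"
  shows "card {w \<in> words F. word_index F w < a} = a"
proof -
  have "word F n \<in> words F" for n by (simp add: words_def)
  then have "{w \<in> words F. word_index F w < a} = word F ` {..<a}"
    using assms
    by (auto simp: word_index_word intro!: image_eqI[where f = "word F"] word_word_index[symmetric])
  moreover have "inj_on (word F) {..<a}"
    using assms by (intro inj_on_inverseI[where g = "word_index F"]) (simp add: word_index_word)
  ultimately show ?thesis by (simp add: card_image)
qed

text \<open>The lengths of the signals are bounded, but only the entropies of the caches are: cache contents
  may be written in unary.\<close>

locale bit_scheme =
  secure_scheme h r D "{..<a}" \<rho> V Z X Y "\<lambda>_. {..<v}" "\<lambda>_. {..<z}" "\<lambda>_. {..<x}" "\<lambda>_ _. {..<y}"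
  for h r D a :: nat and \<rho> :: "'u pmf" and V Z X Y and v z x y :: nat +
  fixes F L\<^sub>1 L\<^sub>2 :: nat
  assumes alphabet_le: "a \<le> 2 ^ F" and server_signals_le: "x \<le> 2 ^ L\<^sub>1" and relay_signals_le: "y \<le> 2 ^ L\<^sub>2"
begin

definition symbol :: "bool list \<Rightarrow> nat" where
  "symbol w = (if word_index F w < a then word_index F w else 0)"

definition file_symbols :: "bool list list \<Rightarrow> nat \<Rightarrow> nat" where
  "file_symbols ws n = symbol (ws ! n)"

definition bit_V :: "nat \<Rightarrow> bool list list \<Rightarrow> 'u \<Rightarrow> bool list" where
  "bit_V j ws u = replicate (V j (file_symbols ws) u) True"

definition bit_Z :: "nat set \<Rightarrow> bool list list \<Rightarrow> 'u \<Rightarrow> bool list" where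
  "bit_Z S ws u = replicate (Z S (file_symbols ws) u) True"

definition bit_X :: "nat \<Rightarrow> (nat set \<Rightarrow> nat) \<Rightarrow> bool list list \<Rightarrow> 'u \<Rightarrow> bool list" where
  "bit_X j d ws u = word L\<^sub>1 (X j d (file_symbols ws) u)"

definition bit_Y :: "nat \<Rightarrow> (nat set \<Rightarrow> nat) \<Rightarrow> nat set \<Rightarrow> bool list \<Rightarrow> bool list \<Rightarrow> bool list" where
  "bit_Y j d S s c = word L\<^sub>2 (Y j d S (word_index L\<^sub>1 s) (length c))"

definition received :: "(nat set \<Rightarrow> nat) \<Rightarrow> nat set \<Rightarrow> bool list list \<Rightarrow> 'u \<Rightarrow> nat \<Rightarrow> bool list" where
  "received d S ws u = (\<lambda>j. if j \<in> S then bit_Y j d S (bit_X j d ws u) (bit_V j ws u) else [])"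

definition bit_decode :: "(nat set \<Rightarrow> nat) \<Rightarrow> nat set \<Rightarrow> bool list \<Rightarrow> (nat \<Rightarrow> bool list) \<Rightarrow> bool list" where
  "bit_decode d S c s = word F (decode d S (length c, \<lambda>j\<in>S. word_index L\<^sub>2 (s j)))"

definition bits_of_view :: "nat set \<Rightarrow> nat \<times> (nat \<Rightarrow> nat) \<Rightarrow> bool list \<times> (nat \<Rightarrow> bool list)" where
  "bits_of_view S = map_prod (\<lambda>n. replicate n True) (\<lambda>s j. if j \<in> S then word L\<^sub>2 (s j) else [])"

abbreviation "joint_pmf \<equiv> pair_pmf (pmf_of_set (files D F)) \<rho>"

lemma symbol_less: "symbol w < a"
  using alphabet_nonempty by (auto simp: symbol_def lessThan_empty_iff)

lemma file_symbols_in: "file_symbols ws \<in> {..<D} \<rightarrow> {..<a}"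
  by (simp add: file_symbols_def symbol_less)

lemma finite_joint: "finite (set_pmf joint_pmf)"
  using finite_randomness by simp

lemma ent_bit_V_le:
  assumes "j < h" and "v \<le> 2 powr b"
  shows "ent joint_pmf (\<lambda>(ws, u). bit_V j ws u) \<le> b"
proof (rule ent_le_if_card_le_powr[OF finite_joint])
  show "finite ((\<lambda>n. replicate n True) ` {..<v})" by simp
  show "card ((\<lambda>n. replicate n True) ` {..<v}) \<le> 2 powr b"
    using card_image_le[of "{..<v}" "\<lambda>n. replicate n True"] assms(2) by simp
  show "(\<lambda>(ws, u). bit_V j ws u) ` set_pmf joint_pmf \<subseteq> (\<lambda>n. replicate n True) ` {..<v}"
    using relay_cache_in[OF assms(1) file_symbols_in] by (auto simp: bit_V_def)
qed

lemma ent_bit_Z_le: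
  assumes "S \<in> users h r" and "z \<le> 2 powr b"
  shows "ent joint_pmf (\<lambda>(ws, u). bit_Z S ws u) \<le> b"
proof (rule ent_le_if_card_le_powr[OF finite_joint])
  show "finite ((\<lambda>n. replicate n True) ` {..<z})" by simp
  show "card ((\<lambda>n. replicate n True) ` {..<z}) \<le> 2 powr b"
    using card_image_le[of "{..<z}" "\<lambda>n. replicate n True"] assms(2) by simp
  show "(\<lambda>(ws, u). bit_Z S ws u) ` set_pmf joint_pmf \<subseteq> (\<lambda>n. replicate n True) ` {..<z}"
    using user_cache_in[OF assms(1) file_symbols_in] by (auto simp: bit_Z_def)
qed

lemma bit_Y_bit_X_bit_V:
  assumes "S \<in> users h r" "j \<in> S" "d \<in> demands h r D" "u \<in> set_pmf \<rho>"
  shows "bit_Y j d S (bit_X j d ws u) (bit_V j ws u) =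
    word L\<^sub>2 (Y j d S (X j d (file_symbols ws) u) (V j (file_symbols ws) u))"
proof -
  have "X j d (file_symbols ws) u < 2 ^ L\<^sub>1"
    using server_signal_in[OF relay_less[OF assms(1,2)] assms(3) file_symbols_in assms(4)]
    by (intro less_le_trans[OF _ server_signals_le]) simp
  then show ?thesis by (simp add: bit_Y_def bit_X_def bit_V_def word_index_word)
qed

lemma bits_of_view:
  assumes "S \<in> users h r" "d \<in> demands h r D" "u \<in> set_pmf \<rho>"
  shows "(bit_Z S ws u, received d S ws u) = bits_of_view S (view d S (file_symbols ws) u)"
  using bit_Y_bit_X_bit_V[OF assms(1) _ assms(2,3)]
  by (simp add: bits_of_view_def user_view_def bit_Z_def received_def fun_eq_iff)

lemma bit_decode_received:
  assumes S: "S \<in> users h r" and d: "d \<in> demands h r D" and u: "u \<in> set_pmf \<rho>"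
  shows "bit_decode d S (bit_Z S ws u) (received d S ws u) = word F (symbol (ws ! d S))"
proof -
  let ?f = "file_symbols ws"
  have "Y j d S (X j d ?f u) (V j ?f u) < 2 ^ L\<^sub>2" if "j \<in> S" for j
    using relay_signal_in[OF S that d file_symbols_in u]
    by (intro less_le_trans[OF _ relay_signals_le]) simp
  then have view: "view d S ?f u = (length (bit_Z S ws u), \<lambda>j\<in>S. word_index L\<^sub>2 (received d S ws u j))"
    using bit_Y_bit_X_bit_V[OF S _ d u]
    by (auto simp: user_view_def bit_Z_def received_def word_index_word intro!: restrict_ext)
  have "decode d S (view d S ?f u) = ?f (d S)"
    by (rule decode_view[OF S d file_symbols_in u])
  then show ?thesis by (simp add: bit_decode_def view file_symbols_def)
qed

lemma prob_decoding_error_le: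
  assumes S: "S \<in> users h r" and d: "d \<in> demands h r D"
  shows "measure_pmf.prob joint_pmf {(ws, u). bit_decode d S (bit_Z S ws u) (received d S ws u) \<noteq> ws ! d S}
    \<le> 1 - a / 2 ^ F"
proof -
  define G where "G = {w \<in> words F. word_index F w < a}"
  have k: "d S < D" using d S by (simp add: demands_def)
  have "bit_decode d S (bit_Z S ws u) (received d S ws u) = ws ! d S"
    if "u \<in> set_pmf \<rho>" "ws ! d S \<in> G" for ws u
    using that by (simp add: bit_decode_received[OF S d] G_def symbol_def word_word_index)
  then have "measure_pmf.prob joint_pmf
      {(ws, u). bit_decode d S (bit_Z S ws u) (received d S ws u) \<noteq> ws ! d S}
      \<le> measure_pmf.prob joint_pmf {(ws, u). ws ! d S \<notin> G}"
    by (intro measure_pmf.finite_measure_mono_AE) (auto simp: AE_measure_pmf_iff)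
  also have "\<dots> = 1 - card G / 2 ^ F"
    by (rule prob_file_notin[OF k]) (simp add: G_def)
  finally show ?thesis by (simp add: G_def card_encodable_words[OF alphabet_le])
qed

lemma leakage_eq_0:
  assumes S: "S \<in> users h r" and d: "d \<in> demands h r D"
  shows "mi joint_pmf (\<lambda>(ws, u). nths ws (- {d S})) (\<lambda>(ws, u). (bit_Z S ws u, received d S ws u)) = 0"
proof (rule mi_other_files_eq_0[OF _ finite_randomness])
  show "d S < D" using d S by (simp add: demands_def)
  show "map_pmf (\<lambda>u. (bit_Z S ws u, received d S ws u)) \<rho> =
      map_pmf (bits_of_view S) (map_pmf (view d S (\<lambda>_. symbol (ws ! d S))) \<rho>)" for ws
  proof -
    have "map_pmf (\<lambda>u. (bit_Z S ws u, received d S ws u)) \<rho> =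
        map_pmf (bits_of_view S) (map_pmf (view d S (file_symbols ws)) \<rho>)"
      unfolding pmf.map_comp o_def by (intro map_pmf_cong refl bits_of_view[OF S d])
    also have "map_pmf (view d S (file_symbols ws)) \<rho> = map_pmf (view d S (\<lambda>_. symbol (ws ! d S))) \<rho>"
      by (rule secure[OF S d file_symbols_in]) (simp_all add: symbol_less file_symbols_def)
    finally show ?thesis .
  qed
qed

end

section \<open>The region of rates of secure codes\<close>

text \<open>File sizes \<open>e\<close> in bits may be any real numbers; this makes the region convex without any rounding.\<close>

definition secure_bit_code :: "nat \<Rightarrow> nat \<Rightarrow> nat \<Rightarrow> real \<Rightarrow> real \<Rightarrow> real \<Rightarrow> real \<Rightarrow> real \<Rightarrow> real \<Rightarrow> bool" where
  "secure_bit_code h r D c e n m b\<^sub>1 b\<^sub>2 \<longleftrightarrow>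
    (\<exists>a v z x y. secure_code h r D a v z x y \<and> c * 2 powr e < a \<and> a \<le> 2 powr e \<and>
      v \<le> 2 powr n \<and> z \<le> 2 powr m \<and> x \<le> 2 powr b\<^sub>1 \<and> y \<le> 2 powr b\<^sub>2)"

definition secure_rate_region :: "nat \<Rightarrow> nat \<Rightarrow> nat \<Rightarrow> (real \<times> real \<times> real \<times> real) set" where
  "secure_rate_region h r D = {(N, M, R\<^sub>1, R\<^sub>2).
    \<forall>c<1. \<forall>\<^sub>F e in at_top. secure_bit_code h r D c e (N * e) (M * e) (R\<^sub>1 * e) (R\<^sub>2 * e)}"

lemma le_power_nat_ceiling_if_le_powr:
  assumes "real n \<le> 2 powr x"
  shows "n \<le> 2 ^ nat \<lceil>x\<rceil>"
proof -
  have "2 powr x \<le> 2 powr real (nat \<lceil>x\<rceil>)" by (intro powr_mono) linarith+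
  then have "real n \<le> 2 powr real (nat \<lceil>x\<rceil>)" using assms by linarith
  then show ?thesis by (simp add: powr_realpow)
qed

lemma secure_bit_codeE:
  fixes F :: nat
  assumes "secure_bit_code h r D c F n m b\<^sub>1 b\<^sub>2"
  obtains a v z x y and \<rho> :: "nat pmf" and V Z X Y where
    "bit_scheme h r D a \<rho> V Z X Y v z x y F (nat \<lceil>b\<^sub>1\<rceil>) (nat \<lceil>b\<^sub>2\<rceil>)"
    and "c * 2 ^ F < a" and "v \<le> 2 powr n" and "z \<le> 2 powr m"
proof -
  from assms obtain a v z x y where code: "secure_code h r D a v z x y"
    and a: "c * 2 powr F < a" "a \<le> 2 powr F" and vz: "v \<le> 2 powr n" "z \<le> 2 powr m"
    and xy: "x \<le> 2 powr b\<^sub>1" "y \<le> 2 powr b\<^sub>2"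
    unfolding secure_bit_code_def by blast
  from code obtain \<rho> :: "nat pmf" and V :: "nat \<Rightarrow> (nat \<Rightarrow> nat) \<Rightarrow> nat \<Rightarrow> nat" and Z X Y where
    "secure_scheme h r D {..<a} \<rho> V Z X Y (\<lambda>_. {..<v}) (\<lambda>_. {..<z}) (\<lambda>_. {..<x}) (\<lambda>_ _. {..<y})"
    unfolding secure_code_def by blast
  moreover have "a \<le> 2 ^ F" using a(2) by (simp add: powr_realpow)
  ultimately have "bit_scheme h r D a \<rho> V Z X Y v z x y F (nat \<lceil>b\<^sub>1\<rceil>) (nat \<lceil>b\<^sub>2\<rceil>)"
    by (intro bit_scheme.intro bit_scheme_axioms.intro le_power_nat_ceiling_if_le_powr xy)
  moreover have "c * 2 ^ F < a" using a(1) by (simp add: powr_realpow)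
  ultimately show thesis using that vz by blast
qed

theorem secure_achievable_if_in_secure_rate_region:
  assumes "(N, M, R\<^sub>1, R\<^sub>2) \<in> secure_rate_region h r D"
  shows "secure_achievable h r D M N R\<^sub>1 R\<^sub>2"
  unfolding secure_achievable_def
proof (intro allI impI, goal_cases)
  case (1 \<epsilon> \<delta>)
  then have "\<forall>\<^sub>F e in at_top. secure_bit_code h r D (1 - \<epsilon>) e (N * e) (M * e) (R\<^sub>1 * e) (R\<^sub>2 * e)"
    using assms by (simp add: secure_rate_region_def)
  then obtain F\<^sub>0 where F\<^sub>0: "secure_bit_code h r D (1 - \<epsilon>) F (N * F) (M * F) (R\<^sub>1 * F) (R\<^sub>2 * F)"
    if "F \<ge> F\<^sub>0" for F :: nat
    using filterlim_real_sequentially unfolding filterlim_iff eventually_sequentially by meson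
  show ?case
  proof (rule exI[of _ F\<^sub>0], intro allI impI, goal_cases)
    case (1 F)
    obtain a v z x y and \<rho> :: "nat pmf" and V Z X Y where
      scheme: "bit_scheme h r D a \<rho> V Z X Y v z x y F (nat \<lceil>R\<^sub>1 * F\<rceil>) (nat \<lceil>R\<^sub>2 * F\<rceil>)"
      and a: "(1 - \<epsilon>) * 2 ^ F < a" and caches: "v \<le> 2 powr (N * F)" "z \<le> 2 powr (M * F)"
      by (rule secure_bit_codeE[OF F\<^sub>0[OF 1]])
    interpret bit_scheme h r D a \<rho> V Z X Y v z x y F "nat \<lceil>R\<^sub>1 * F\<rceil>" "nat \<lceil>R\<^sub>2 * F\<rceil>" by (fact scheme)
    have "1 - a / 2 ^ F < \<epsilon>" using a by (simp add: field_simps)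
    then have error: "measure_pmf.prob joint_pmf
        {(ws, u). bit_decode d S (bit_Z S ws u) (received d S ws u) \<noteq> ws ! d S} < \<epsilon>"
      if "d \<in> demands h r D" "S \<in> users h r" for d S
      using prob_decoding_error_le[OF that(2,1)] by linarith
    have leakage: "mi joint_pmf (\<lambda>(ws, u). nths ws (- {d S}))
        (\<lambda>(ws, u). (bit_Z S ws u, received d S ws u)) < \<delta>"
      if "d \<in> demands h r D" "S \<in> users h r" for d S
      using leakage_eq_0[OF that(2,1)] \<open>0 < \<delta>\<close> by simp
    show ?case
      unfolding Let_def
      by (rule exI[of _ \<rho>], rule exI[of _ bit_V], rule exI[of _ bit_Z], rule exI[of _ bit_X],
          rule exI[of _ bit_Y], rule exI[of _ bit_decode])
        (intro conjI allI ballI impI finite_randomness ent_bit_V_le ent_bit_Z_le caches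
          error[unfolded received_def] leakage[unfolded received_def], simp_all add: bit_X_def bit_Y_def)
  qed
qed

lemma secure_bit_code_add:
  assumes "secure_bit_code h r D c e n m b\<^sub>1 b\<^sub>2" and "secure_bit_code h r D c' e' n' m' b\<^sub>1' b\<^sub>2'"
    and "0 \<le> c" and "0 \<le> c'"
  shows "secure_bit_code h r D (c * c') (e + e') (n + n') (m + m') (b\<^sub>1 + b\<^sub>1') (b\<^sub>2 + b\<^sub>2')"
proof -
  from assms(1) obtain a v z x y where code: "secure_code h r D a v z x y" "c * 2 powr e < a" "a \<le> 2 powr e"
    "v \<le> 2 powr n" "z \<le> 2 powr m" "x \<le> 2 powr b\<^sub>1" "y \<le> 2 powr b\<^sub>2"
    unfolding secure_bit_code_def by blast
  from assms(2) obtain a' v' z' x' y' where code': "secure_code h r D a' v' z' x' y'" "c' * 2 powr e' < a'"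
    "a' \<le> 2 powr e'" "v' \<le> 2 powr n'" "z' \<le> 2 powr m'" "x' \<le> 2 powr b\<^sub>1'" "y' \<le> 2 powr b\<^sub>2'"
    unfolding secure_bit_code_def by blast
  have "(c * 2 powr e) * (c' * 2 powr e') < real a * real a'"
    using code(2) code'(2) assms(3,4) by (intro mult_strict_mono') auto
  then have "c * c' * 2 powr (e + e') < real (a * a')"
    by (simp add: powr_add mult_ac)
  moreover have "real (k * k') \<le> 2 powr (b + b')" if "k \<le> 2 powr b" "k' \<le> 2 powr b'"
    for k k' :: nat and b b'
    using mult_mono[OF that] by (simp add: powr_add)
  ultimately show ?thesis
    unfolding secure_bit_code_def using secure_code_mult[OF code(1) code'(1)] code(3-) code'(3-) by blast
qed

lemma secure_bit_code_mono:
  assumes "secure_bit_code h r D c e n m b\<^sub>1 b\<^sub>2" and "c' \<le> c"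
  shows "secure_bit_code h r D c' e n m b\<^sub>1 b\<^sub>2"
proof -
  have "c' * 2 powr e \<le> c * 2 powr e" using assms(2) by simp
  then show ?thesis using assms(1) unfolding secure_bit_code_def by (meson le_less_trans)
qed

theorem convex_secure_rate_region: "convex (secure_rate_region h r D)"
proof (rule convexI)
  fix P P' and s t :: real
  assume P: "P \<in> secure_rate_region h r D" "P' \<in> secure_rate_region h r D"
    and st: "0 \<le> s" "0 \<le> t" "s + t = 1"
  obtain N M R\<^sub>1 R\<^sub>2 N' M' R\<^sub>1' R\<^sub>2' where P_eq: "P = (N, M, R\<^sub>1, R\<^sub>2)" "P' = (N', M', R\<^sub>1', R\<^sub>2')"
    by (cases P, cases P') auto
  consider "s = 0" | "t = 0" | "0 < s" "0 < t" using st by linarith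
  then show "s *\<^sub>R P + t *\<^sub>R P' \<in> secure_rate_region h r D"
  proof cases
    case 3
    have scale: "\<forall>\<^sub>F e in at_top. Q (k * e)" if "eventually Q at_top" "0 < k" for k :: real and Q
      using that filterlim_tendsto_pos_mult_at_top[OF tendsto_const that(2) filterlim_ident]
      by (auto simp: filterlim_iff)
    have "\<forall>\<^sub>F e in at_top. secure_bit_code h r D c e ((s * N + t * N') * e) ((s * M + t * M') * e)
        ((s * R\<^sub>1 + t * R\<^sub>1') * e) ((s * R\<^sub>2 + t * R\<^sub>2') * e)" if "c < 1" for c
    proof -
      define c\<^sub>0 where "c\<^sub>0 = (1 + max c 0) / 2"
      have "0 \<le> (1 - max c 0)\<^sup>2" by simp
      then have c\<^sub>0: "0 \<le> c\<^sub>0" "c\<^sub>0 < 1" "c \<le> c\<^sub>0 * c\<^sub>0"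
        using \<open>c < 1\<close> by (auto simp: c\<^sub>0_def power2_eq_square field_simps)
      have "\<forall>\<^sub>F e in at_top. secure_bit_code h r D c\<^sub>0 e (N * e) (M * e) (R\<^sub>1 * e) (R\<^sub>2 * e)"
        "\<forall>\<^sub>F e in at_top. secure_bit_code h r D c\<^sub>0 e (N' * e) (M' * e) (R\<^sub>1' * e) (R\<^sub>2' * e)"
        using P c\<^sub>0(2) by (simp_all add: P_eq secure_rate_region_def)
      from this[THEN scale] 3 have
        "\<forall>\<^sub>F e in at_top. secure_bit_code h r D c\<^sub>0 (s * e) (N * (s * e)) (M * (s * e))
          (R\<^sub>1 * (s * e)) (R\<^sub>2 * (s * e))"
        "\<forall>\<^sub>F e in at_top. secure_bit_code h r D c\<^sub>0 (t * e) (N' * (t * e)) (M' * (t * e))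
          (R\<^sub>1' * (t * e)) (R\<^sub>2' * (t * e))"
        by blast+
      then show ?thesis
      proof eventually_elim
        case (elim e)
        have "s * e + t * e = e" using st(3) by (simp flip: distrib_right)
        then show ?case
          using secure_bit_code_mono[OF secure_bit_code_add[OF elim c\<^sub>0(1,1)] c\<^sub>0(3)]
          by (simp add: algebra_simps)
      qed
    qed
    then show ?thesis by (simp add: P_eq secure_rate_region_def)
  qed (use P st in auto)
qed

section \<open>Choosing the modulus\<close>

text \<open>The largest number up to \<open>2 powr x\<close> that is \<open>1\<close> modulo \<open>m\<close>, provided that \<open>0 \<le> x\<close>.\<close>

definition residue_floor :: "nat \<Rightarrow> real \<Rightarrow> nat" where
  "residue_floor m x = (nat \<lfloor>2 powr x\<rfloor> - 1) div m * m + 1"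

lemma residue_floor_cong: "[residue_floor m x = 1] (mod m)"
  by (simp only: residue_floor_def cong_def mod_mult_self3)

lemma residue_floor_bounds:
  assumes "0 < m" "0 \<le> x"
  shows "real (residue_floor m x) \<le> 2 powr x" and "2 powr x - (real m + 1) \<le> real (residue_floor m x)"
proof -
  define y where "y = nat \<lfloor>2 powr x\<rfloor>"
  have "1 \<le> 2 powr x" using assms(2) by (simp add: ge_one_powr_ge_zero)
  then have y: "1 \<le> y" "real y \<le> 2 powr x" "2 powr x \<le> real y + 1"
    unfolding y_def by linarith+
  have "residue_floor m x + (y - 1) mod m = y"
    using y(1) div_mult_mod_eq[of "y - 1" m] by (simp add: residue_floor_def y_def[symmetric])
  moreover have "(y - 1) mod m < m" using assms(1) by simp
  ultimately have "residue_floor m x \<le> y" "y \<le> residue_floor m x + m" by linarith+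
  then show "real (residue_floor m x) \<le> 2 powr x" "2 powr x - (real m + 1) \<le> real (residue_floor m x)"
    using y by linarith+
qed

lemma residue_floor_asymp:
  assumes "0 < m"
  shows "((\<lambda>x. residue_floor m x / 2 powr x) \<longlongrightarrow> 1) at_top"
proof (rule tendsto_sandwich)
  show "((\<lambda>x. 1 - (real m + 1) / 2 powr x) \<longlongrightarrow> 1) at_top" by real_asymp
  show "\<forall>\<^sub>F x in at_top. 1 - (real m + 1) / 2 powr x \<le> residue_floor m x / 2 powr x"
    using eventually_ge_at_top[of 0]
  proof eventually_elim
    case (elim x)
    then show ?case
      using divide_right_mono[OF residue_floor_bounds(2)[OF assms elim], of "2 powr x"]
      by (simp add: diff_divide_distrib)
  qed
  show "\<forall>\<^sub>F x in at_top. residue_floor m x / 2 powr x \<le> 1"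
    using eventually_ge_at_top[of 0] by eventually_elim (simp add: residue_floor_bounds(1)[OF assms])
qed (rule tendsto_const)

theorem rates_of_power_codes_in_secure_rate_region:
  assumes m: "0 < m" and k: "0 < k"
    and code: "\<And>p. 0 < p \<Longrightarrow> [p = 1] (mod m) \<Longrightarrow> secure_code h r D (p ^ k) (p ^ kv) (p ^ kz) (p ^ kx) (p ^ ky)"
  shows "(kv / k, kz / k, kx / k, ky / k) \<in> secure_rate_region h r D"
proof -
  define p where "p e = residue_floor m (e / k)" for e
  have "\<forall>\<^sub>F e in at_top. secure_bit_code h r D c e (kv / k * e) (kz / k * e) (kx / k * e) (ky / k * e)"
    if "c < 1" for c
  proof -
    have "filterlim (\<lambda>e. e / k) at_top at_top" using k by real_asymp
    then have "((\<lambda>e. p e / 2 powr (e / k)) \<longlongrightarrow> 1) at_top"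
      unfolding p_def by (rule filterlim_compose[OF residue_floor_asymp[OF m]])
    then have "((\<lambda>e. (p e / 2 powr (e / k)) ^ k) \<longlongrightarrow> 1 ^ k) at_top" by (rule tendsto_power)
    then have "\<forall>\<^sub>F e in at_top. c < (p e / 2 powr (e / k)) ^ k"
      using that by (intro order_tendstoD(1)[where y = "1 ^ k"]) auto
    then show ?thesis
      using eventually_ge_at_top[of 0]
    proof eventually_elim
      case (elim e)
      have powr: "(2 powr (e / k)) ^ l = 2 powr (l / k * e)" for l :: nat
        by (simp add: powr_power mult.commute)
      have "real (p e) \<le> 2 powr (e / k)"
        unfolding p_def using m elim(2) by (intro residue_floor_bounds(1)) auto
      then have le: "real (p e ^ l) \<le> 2 powr (l / k * e)" for l
        unfolding powr[symmetric] by (simp add: power_mono)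
      have "secure_code h r D (p e ^ k) (p e ^ kv) (p e ^ kz) (p e ^ kx) (p e ^ ky)"
      proof (rule code)
        show "0 < p e" by (simp add: p_def residue_floor_def)
        show "[p e = 1] (mod m)" unfolding p_def by (rule residue_floor_cong)
      qed
      moreover have "c * 2 powr e < real (p e ^ k)"
        using elim(1) powr[of k] k by (simp add: power_divide pos_less_divide_eq)
      ultimately show ?case
        unfolding secure_bit_code_def using le le[of k] k by fastforce
    qed
  qed
  then show ?thesis by (simp add: secure_rate_region_def)
qed

section \<open>User groups\<close>

definition relay_users :: "nat \<Rightarrow> nat \<Rightarrow> nat \<Rightarrow> nat set set" where
  "relay_users h r j = {S \<in> users h r. j \<in> S}"

definition user_groups :: "nat \<Rightarrow> nat \<Rightarrow> nat \<Rightarrow> nat \<Rightarrow> nat set set set" where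
  "user_groups h r j k = {T. T \<subseteq> relay_users h r j \<and> card T = k}"

lemma finite_users [simp]: "finite (users h r)"
  by (rule finite_subset[of _ "Pow {..<h}"]) (auto simp: users_def)

lemma finite_relay_users [simp]: "finite (relay_users h r j)"
  by (simp add: relay_users_def)

lemma finite_user_groups [simp]: "finite (user_groups h r j k)"
  by (rule finite_subset[of _ "Pow (relay_users h r j)"]) (auto simp: user_groups_def)

lemma user_groups_subset: "user_groups h r j k \<subseteq> Pow (users h r)"
  by (auto simp: user_groups_def relay_users_def)

lemma finite_user_group: "T \<in> user_groups h r j k \<Longrightarrow> finite T"
  by (rule finite_subset[of _ "relay_users h r j"]) (simp_all add: user_groups_def)

lemma card_user: "S \<in> users h r \<Longrightarrow> card S = r"
  by (simp add: users_def)

lemma finite_user: "S \<in> users h r \<Longrightarrow> finite S"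
  by (auto simp: users_def intro: finite_subset)

lemma card_subsets_containing:
  assumes "finite A" "x \<in> A"
  shows "card {B. B \<subseteq> A \<and> card B = k \<and> x \<in> B} = (card A choose k) - ((card A - 1) choose k)"
proof -
  have "{B. B \<subseteq> A \<and> card B = k \<and> x \<in> B} = {B. B \<subseteq> A \<and> card B = k} - {B. B \<subseteq> A - {x} \<and> card B = k}"
    by auto
  also have "card \<dots> = card {B. B \<subseteq> A \<and> card B = k} - card {B. B \<subseteq> A - {x} \<and> card B = k}"
    using assms by (intro card_Diff_subset) auto
  finally show ?thesis using assms by (simp add: n_subsets)
qed

lemma card_relay_users:
  assumes "0 < r" "j < h"
  shows "card (relay_users h r j) = Khat h r"
proof -
  have "relay_users h r j = {S. S \<subseteq> {..<h} \<and> card S = r \<and> j \<in> S}"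
    by (auto simp: relay_users_def users_def)
  moreover obtain h' r' where "h = Suc h'" "r = Suc r'" using assms by (cases h; cases r) auto
  ultimately show ?thesis
    using card_subsets_containing[of "{..<h}" j r] assms by (simp add: Khat_def)
qed

lemma card_user_groups:
  assumes "0 < r" "j < h"
  shows "card (user_groups h r j k) = (Khat h r choose k)"
  using assms by (simp add: user_groups_def n_subsets card_relay_users)

lemma card_user_groups_containing:
  assumes "0 < r" "S \<in> users h r" "j \<in> S"
  shows "card {T \<in> user_groups h r j k. S \<in> T} = (Khat h r choose k) - ((Khat h r - 1) choose k)"
  using card_subsets_containing[of "relay_users h r j" S k] assms
    card_relay_users[OF assms(1) relay_less[OF assms(2,3)]]
  by (simp add: user_groups_def relay_users_def conj_ac)

section \<open>Codes at the corner points\<close>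

definition node :: "nat \<Rightarrow> nat \<Rightarrow> nat set set \<Rightarrow> int" where
  "node h r T = int (to_nat_on (Pow (users h r)) T)"

definition node_bound :: "nat \<Rightarrow> nat \<Rightarrow> nat" where
  "node_bound h r = max h (card (Pow (users h r)))"

locale residue_code =
  fixes h r D :: nat and p :: int
  assumes r_pos: "0 < r" and p_pos: "0 < p"
    and coprime_differences: "pairwise (\<lambda>x y. coprime p (x - y)) (int ` {..<node_bound h r})"
begin

definition relay_symbol :: "(nat \<Rightarrow> int) \<Rightarrow> nat \<Rightarrow> int" where
  "relay_symbol c j = poly_eval r c (int j) mod p"

lemma relay_symbol_in: "relay_symbol c j \<in> {0..<p}"
  using p_pos by (simp add: relay_symbol_def)

lemma coeff_eq_if_relay_symbols_eq:
  assumes S: "S \<in> users h r" and symbols: "\<And>j. j \<in> S \<Longrightarrow> relay_symbol b j = relay_symbol c j"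
    and i: "i < r" and range: "b i \<in> {0..<p}" "c i \<in> {0..<p}"
  shows "b i = c i"
proof -
  have "finite (int ` S)" "r \<le> card (int ` S)"
    using S by (simp_all add: finite_user card_user card_image)
  moreover have "pairwise (\<lambda>x y. coprime p (x - y)) (int ` S)"
    using S by (intro pairwise_subset[OF coprime_differences])
      (auto simp: users_def node_bound_def less_max_iff_disj)
  moreover have "[poly_eval r b x = poly_eval r c x] (mod p)" if "x \<in> int ` S" for x
    using that symbols by (auto simp: relay_symbol_def cong_def)
  ultimately have "[b i = c i] (mod p)"
    using i by (rule coeffs_cong_if_poly_eval_cong)
  then show ?thesis using range by (auto intro: cong_less_imp_eq_int)
qed

text \<open>The relays cache their code symbols, so the server sends nothing.\<close>

lemma secure_code_relay_cached: "secure_code h r D (nat p ^ r) (nat p ^ D) 1 1 (nat p)"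
proof -
  define V where "V j f u = (\<lambda>n\<in>{..<D}. relay_symbol (f n) j)"
    for j and f :: "nat \<Rightarrow> nat \<Rightarrow> int" and u :: unit
  define Y where "Y j d S x v = v (d S)"
    for j :: nat and d and S :: "nat set" and x :: unit and v :: "nat \<Rightarrow> int"
  let ?view = "user_view V (\<lambda>_ _ _. ()) (\<lambda>_ _ _ _. ()) Y"
  let ?A = "{..<r} \<rightarrow>\<^sub>E {0..<p}"
  interpret secure_scheme h r D ?A "return_pmf ()" V "\<lambda>_ _ _. ()" "\<lambda>_ _ _ _. ()" Y
    "\<lambda>_. {..<D} \<rightarrow>\<^sub>E {0..<p}" "\<lambda>_. {()}" "\<lambda>_. {()}" "\<lambda>_ _. {0..<p}"
  proof
    have view: "?view d S f u = ((), \<lambda>j\<in>S. relay_symbol (f (d S)) j)"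
      if "S \<in> users h r" "d \<in> demands h r D" for S d f u
      using that by (simp add: user_view_def V_def Y_def demands_def)
    fix S d f f' u u'
    assume S: "S \<in> users h r" and d: "d \<in> demands h r D"
    show "f (d S) = f' (d S)" if f: "f \<in> {..<D} \<rightarrow> ?A" "f' \<in> {..<D} \<rightarrow> ?A"
      and eq: "?view d S f u = ?view d S f' u'"
    proof (rule PiE_ext)
      show A: "f (d S) \<in> ?A" "f' (d S) \<in> ?A" using f d S by (auto simp: demands_def)
      have symbols: "relay_symbol (f (d S)) j = relay_symbol (f' (d S)) j" if "j \<in> S" for j
        using fun_cong[OF arg_cong[OF eq[unfolded view[OF S d]], of snd], of j] that by simp
      show "f (d S) i = f' (d S) i" if i: "i \<in> {..<r}" for i
        by (rule coeff_eq_if_relay_symbols_eq[OF S symbols _ PiE_mem[OF A(1) i] PiE_mem[OF A(2) i]])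
          (use i in auto)
    qed
    show "map_pmf (?view d S f) (return_pmf ()) =
        map_pmf (?view d S f') (return_pmf ())" if "f (d S) = f' (d S)"
      using that by (simp add: view[OF S d])
    show "Y j d S () (V j f u) \<in> {0..<p}" for j
      using S d relay_symbol_in by (simp add: Y_def V_def demands_def)
  next
    show "?A \<noteq> {}" using p_pos by (simp add: PiE_eq_empty_iff)
    show "V j f u \<in> {..<D} \<rightarrow>\<^sub>E {0..<p}" for j f u using relay_symbol_in by (simp add: V_def)
  qed (simp_all add: finite_PiE)
  show ?thesis using secure_code[of "nat p ^ D" 1 1 "nat p"] by (simp add: card_PiE)
qed

end

type_synonym coded_file = "nat \<times> nat \<Rightarrow> int"
type_synonym sharing_keys = "nat \<times> nat \<times> nat \<Rightarrow> int"

locale secret_sharing_code = residue_code +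
  fixes s :: nat
  assumes s_less: "s < Khat h r"
begin

abbreviation "groups j k \<equiv> user_groups h r j k"

definition msg_len :: nat where
  "msg_len = ((Khat h r - 1) choose s)"

definition key_len :: nat where
  "key_len = (Khat h r choose s) - msg_len"

text \<open>Symbol \<open>(i, l)\<close> of a file is symbol \<open>i\<close> of the message of the \<open>l\<close>-th code word across the relays, and
  \<open>u (j, n, l)\<close> is symbol \<open>l\<close> of the key that protects file \<open>n\<close> at relay \<open>j\<close>. The shares of a file at a
  relay that a user caches number exactly \<open>key_len\<close>, so they reveal nothing, while all shares together
  determine the relay symbols.\<close>

definition alphabet :: "coded_file set" where
  "alphabet = {..<r} \<times> {..<msg_len} \<rightarrow>\<^sub>E {0..<p}"

definition key_idx :: "(nat \<times> nat \<times> nat) set" where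
  "key_idx = {..<h} \<times> {..<D} \<times> {..<key_len}"

definition keys :: "sharing_keys set" where
  "keys = key_idx \<rightarrow>\<^sub>E {0..<p}"

definition message :: "coded_file \<Rightarrow> nat \<Rightarrow> nat \<Rightarrow> int" where
  "message w j l = relay_symbol (\<lambda>i. w (i, l)) j"

definition share :: "(nat \<Rightarrow> coded_file) \<Rightarrow> sharing_keys \<Rightarrow> nat \<Rightarrow> nat \<Rightarrow> nat set set \<Rightarrow> int" where
  "share f u j n T = ramp_share key_len msg_len (\<lambda>l. u (j, n, l)) (message (f n) j) (node h r T) mod p"

definition cached_idx :: "nat set \<Rightarrow> (nat \<times> nat \<times> nat set set) set" where
  "cached_idx S = (SIGMA j:S. {..<D} \<times> {T \<in> groups j s. S \<in> T})"

definition V :: "nat \<Rightarrow> (nat \<Rightarrow> coded_file) \<Rightarrow> sharing_keys \<Rightarrow> unit" where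
  "V j f u = ()"

definition Z :: "nat set \<Rightarrow> (nat \<Rightarrow> coded_file) \<Rightarrow> sharing_keys \<Rightarrow> nat \<times> nat \<times> nat set set \<Rightarrow> int" where
  "Z S f u = restrict (\<lambda>(j, n, T). share f u j n T) (cached_idx S)"

definition X :: "nat \<Rightarrow> (nat set \<Rightarrow> nat) \<Rightarrow> (nat \<Rightarrow> coded_file) \<Rightarrow> sharing_keys \<Rightarrow> nat set set \<Rightarrow> int" where
  "X j d f u = (\<lambda>T\<in>groups j (Suc s). (\<Sum>S\<in>T. share f u j (d S) (T - {S})) mod p)"

definition Y :: "nat \<Rightarrow> (nat set \<Rightarrow> nat) \<Rightarrow> nat set \<Rightarrow> (nat set set \<Rightarrow> int) \<Rightarrow> unit \<Rightarrow> nat set set \<Rightarrow> int" where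
  "Y j d S x v = restrict x {T \<in> groups j (Suc s). S \<in> T}"

abbreviation "view \<equiv> user_view V Z X Y"

lemma share_in: "share f u j n T \<in> {0..<p}"
  using p_pos by (simp add: share_def)

lemma node_in:
  assumes "T \<subseteq> users h r"
  shows "node h r T \<in> int ` {..<node_bound h r}"
  using to_nat_on_less_card[of "Pow (users h r)" T] assms
  by (auto simp: node_def node_bound_def less_max_iff_disj)

lemma card_nodes:
  assumes "\<T> \<subseteq> Pow (users h r)"
  shows "card (node h r ` \<T>) = card \<T>"
proof (rule card_image)
  have "inj_on (to_nat_on (Pow (users h r))) \<T>"
    using assms by (intro inj_on_subset[OF inj_on_to_nat_on] countable_finite) auto
  then show "inj_on (node h r) \<T>" by (simp add: inj_on_def node_def)
qed

lemma pairwise_coprime_nodes: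
  assumes "\<T> \<subseteq> Pow (users h r)"
  shows "pairwise (\<lambda>x y. coprime p (x - y)) (node h r ` \<T>)"
  using assms node_in by (intro pairwise_subset[OF coprime_differences]) blast

lemma msg_len_le: "msg_len \<le> (Khat h r choose s)"
  unfolding msg_len_def by (cases "Khat h r"; cases s) simp_all

lemma card_groups_containing:
  assumes "S \<in> users h r" "j \<in> S"
  shows "card {T \<in> groups j s. S \<in> T} = key_len"
    and "card {T \<in> groups j (Suc s). S \<in> T} = msg_len"
  using s_less card_user_groups_containing[OF r_pos assms]
  by (cases "Khat h r"; simp add: key_len_def msg_len_def)+

lemma message_eq_if_shares_eq:
  assumes j: "j < h" and shares: "\<And>T. T \<in> groups j s \<Longrightarrow> share f u j n T = share f' u' j n T"
    and l: "l < msg_len"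
  shows "message (f n) j l = message (f' n) j l"
proof -
  have "[message (f n) j l = message (f' n) j l] (mod p)"
  proof (rule msg_cong_if_ramp_shares_cong[where A = "node h r ` groups j s"])
    show "key_len + msg_len \<le> card (node h r ` groups j s)"
      using msg_len_le by (simp add: card_nodes user_groups_subset card_user_groups[OF r_pos j] key_len_def)
    show "pairwise (\<lambda>x y. coprime p (x - y)) (node h r ` groups j s)"
      by (intro pairwise_coprime_nodes user_groups_subset)
    show "[ramp_share key_len msg_len (\<lambda>l. u (j, n, l)) (message (f n) j) x =
        ramp_share key_len msg_len (\<lambda>l. u' (j, n, l)) (message (f' n) j) x] (mod p)"
      if "x \<in> node h r ` groups j s" for x
      using that shares by (auto simp: share_def cong_def)
  qed (simp_all add: l)
  then show ?thesis by (simp add: message_def relay_symbol_def cong_def)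
qed

lemma file_eq_if_messages_eq:
  assumes S: "S \<in> users h r" and w: "w \<in> alphabet" "w' \<in> alphabet"
    and messages: "\<And>j l. j \<in> S \<Longrightarrow> l < msg_len \<Longrightarrow> message w j l = message w' j l"
  shows "w = w'"
proof (rule PiE_ext[OF w[unfolded alphabet_def]])
  fix x assume x: "x \<in> {..<r} \<times> {..<msg_len}"
  obtain i l where il: "x = (i, l)" "i < r" "l < msg_len" using x by auto
  have "w (i, l) \<in> {0..<p}" "w' (i, l) \<in> {0..<p}"
    using PiE_mem[OF w(1)[unfolded alphabet_def] x] PiE_mem[OF w(2)[unfolded alphabet_def] x] il(1)
    by simp_all
  from coeff_eq_if_relay_symbols_eq[OF S messages[OF _ il(3), unfolded message_def] il(2) this]
  show "w x = w' x" unfolding il(1) .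
qed

lemma view_eqD:
  assumes "view d S f u = view d S f' u'" and "j \<in> S"
  shows "n < D \<Longrightarrow> T \<in> groups j s \<Longrightarrow> S \<in> T \<Longrightarrow> share f u j n T = share f' u' j n T"
    and "T \<in> groups j (Suc s) \<Longrightarrow> S \<in> T \<Longrightarrow> X j d f u T = X j d f' u' T"
proof -
  have Z: "Z S f u = Z S f' u'" using assms(1) by (simp add: user_view_def)
  show "share f u j n T = share f' u' j n T" if "n < D" "T \<in> groups j s" "S \<in> T"
    using fun_cong[OF Z, of "(j, n, T)"] that assms(2) by (simp add: Z_def cached_idx_def)
  have "Y j d S (X j d f u) () = Y j d S (X j d f' u') ()"
    using fun_cong[OF arg_cong[OF assms(1), of snd], of j] assms(2) by (simp add: user_view_def V_def)
  from fun_cong[OF this, of T] show "X j d f u T = X j d f' u' T" if "T \<in> groups j (Suc s)" "S \<in> T"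
    using that by (simp add: Y_def)
qed

text \<open>A share that the user does not cache is the only term it does not know in some transmitted sum.\<close>

lemma share_eq_if_view_eq:
  assumes S: "S \<in> users h r" and d: "d \<in> demands h r D" and view: "view d S f u = view d S f' u'"
    and j: "j \<in> S" and T: "T \<in> groups j s"
  shows "share f u j (d S) T = share f' u' j (d S) T"
proof (cases "S \<in> T")
  case True
  then show ?thesis using view_eqD(1)[OF view j _ T] d S by (simp add: demands_def)
next
  case False
  define T' where "T' = insert S T"
  have finT: "finite T" using T by (rule finite_user_group)
  have T': "T' \<in> groups j (Suc s)" "S \<in> T'"
    using T S j False finT by (auto simp: T'_def user_groups_def relay_users_def)
  have "T' - {S} = T" using False by (auto simp: T'_def)
  then have X: "X j d f u T' = (share f u j (d S) T + (\<Sum>S'\<in>T. share f u j (d S') (T' - {S'}))) mod p"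
    for f u
    using False finT T'(1) by (simp add: X_def) (simp add: T'_def)
  have "share f u j (d S') (T' - {S'}) = share f' u' j (d S') (T' - {S'})" if S': "S' \<in> T" for S'
  proof (rule view_eqD(1)[OF view j])
    show "d S' < D" using S' T d by (auto simp: user_groups_def relay_users_def demands_def)
    show "T' - {S'} \<in> groups j s" "S \<in> T' - {S'}"
      using S' False finT T'(1) by (auto simp: T'_def user_groups_def)
  qed
  then have "[share f u j (d S) T + (\<Sum>S'\<in>T. share f' u' j (d S') (T' - {S'})) =
      share f' u' j (d S) T + (\<Sum>S'\<in>T. share f' u' j (d S') (T' - {S'}))] (mod p)"
    using view_eqD(2)[OF view j T'] by (simp add: X cong_def)
  then have "[share f u j (d S) T = share f' u' j (d S) T] (mod p)"
    by (simp only: cong_add_rcancel)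
  then show ?thesis by (simp add: cong_def share_def)
qed

definition shift_keys :: "sharing_keys \<Rightarrow> sharing_keys \<Rightarrow> sharing_keys" where
  "shift_keys \<delta> u = (\<lambda>i\<in>key_idx. (u i + \<delta> i) mod p)"

lemma bij_betw_shift_keys: "bij_betw (shift_keys \<delta>) keys keys"
  by (rule bij_betw_byWitness[where f' = "shift_keys (\<lambda>i. - \<delta> i)"])
    (use p_pos in \<open>auto simp: shift_keys_def keys_def mod_simps PiE_iff extensional_def fun_eq_iff\<close>)

lemma share_shift_keys:
  assumes "j < h" "n < D"
  shows "share f (shift_keys \<delta> u) j n T =
    ramp_share key_len msg_len (\<lambda>l. u (j, n, l) + \<delta> (j, n, l)) (message (f n) j) (node h r T) mod p"
  unfolding share_def cong_def[symmetric]
  by (rule ramp_share_cong_mod) (use assms in \<open>simp add: shift_keys_def key_idx_def cong_def\<close>)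

lemma ex_hiding_shift:
  assumes S: "S \<in> users h r"
  shows "\<exists>\<delta>. \<forall>u. \<forall>j\<in>S. \<forall>n<D. \<forall>T\<in>groups j s. S \<in> T \<or> f n = f' n \<longrightarrow>
    share f' (shift_keys \<delta> u) j n T = share f u j n T"
proof -
  define hides where "hides j n \<delta> \<longleftrightarrow> (\<forall>T\<in>groups j s. S \<in> T \<or> f n = f' n \<longrightarrow> (\<forall>key.
      [ramp_share key_len msg_len (\<lambda>l. key l + \<delta> l) (message (f' n) j) (node h r T) =
        ramp_share key_len msg_len key (message (f n) j) (node h r T)] (mod p)))" for j n \<delta>
  have "\<exists>\<delta>. hides j n \<delta>" if j: "j \<in> S" for j n
  proof (cases "f n = f' n")
    case True
    then show ?thesis unfolding hides_def by (intro exI[of _ "\<lambda>_. 0"]) simp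
  next
    case False
    let ?A = "node h r ` {T \<in> groups j s. S \<in> T}"
    have sub: "{T \<in> groups j s. S \<in> T} \<subseteq> Pow (users h r)" using user_groups_subset by blast
    have "card ?A = key_len" using card_nodes[OF sub] card_groups_containing(1)[OF S j] by simp
    then show ?thesis
      using ex_key_shift[OF p_pos _ pairwise_coprime_nodes[OF sub], of msg_len "message (f' n) j"
          "message (f n) j"] False
      by (auto simp: hides_def)
  qed
  then obtain \<delta> where \<delta>: "\<And>j n. j \<in> S \<Longrightarrow> hides j n (\<delta> j n)" by metis
  have "share f' (shift_keys (\<lambda>(j, n, l). \<delta> j n l) u) j n T = share f u j n T"
    if "j \<in> S" "n < D" "T \<in> groups j s" "S \<in> T \<or> f n = f' n" for u j n T
    unfolding share_shift_keys[OF relay_less[OF S that(1)] that(2)]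
    using \<delta>[unfolded hides_def, rule_format, OF that(1,3,4), of "\<lambda>l. u (j, n, l)"]
    by (simp add: share_def cong_def)
  then show ?thesis by (intro exI[of _ "\<lambda>(j, n, l). \<delta> j n l"] allI ballI impI)
qed

lemma view_eq_if_shares_eq:
  assumes S: "S \<in> users h r" and d: "d \<in> demands h r D" and f: "f (d S) = f' (d S)"
    and shares: "\<And>j n T. j \<in> S \<Longrightarrow> n < D \<Longrightarrow> T \<in> groups j s \<Longrightarrow> S \<in> T \<or> f n = f' n \<Longrightarrow>
      share f' u' j n T = share f u j n T"
  shows "view d S f' u' = view d S f u"
proof -
  have "Z S f' u' = Z S f u"
    unfolding Z_def by (intro restrict_ext) (auto simp: cached_idx_def intro!: shares)
  moreover have "X j d f' u' T = X j d f u T" if j: "j \<in> S" and T: "T \<in> groups j (Suc s)" "S \<in> T" for j T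
  proof -
    have finT: "finite T" using T(1) by (rule finite_user_group)
    have "share f' u' j (d S') (T - {S'}) = share f u j (d S') (T - {S'})" if S': "S' \<in> T" for S'
    proof (rule shares[OF j])
      show "d S' < D" using S' T(1) d by (auto simp: user_groups_def relay_users_def demands_def)
      show "T - {S'} \<in> groups j s" using S' T(1) finT by (auto simp: user_groups_def)
      show "S \<in> T - {S'} \<or> f (d S') = f' (d S')" using T(2) f by auto
    qed
    then show ?thesis using T(1) by (simp add: X_def)
  qed
  ultimately show ?thesis by (auto simp: user_view_def Y_def intro!: restrict_ext)
qed

lemma finite_keys: "finite keys"
  unfolding keys_def key_idx_def by (intro finite_PiE) auto

lemma keys_nonempty: "keys \<noteq> {}"
  using p_pos by (simp add: keys_def PiE_eq_empty_iff)

lemma map_view_keys_eq: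
  assumes S: "S \<in> users h r" and d: "d \<in> demands h r D" and f: "f (d S) = f' (d S)"
  shows "map_pmf (view d S f) (pmf_of_set keys) = map_pmf (view d S f') (pmf_of_set keys)"
proof -
  obtain \<delta> where "\<forall>u. \<forall>j\<in>S. \<forall>n<D. \<forall>T\<in>groups j s. S \<in> T \<or> f n = f' n \<longrightarrow>
      share f' (shift_keys \<delta> u) j n T = share f u j n T"
    using ex_hiding_shift[OF S] by blast
  then have "view d S f' (shift_keys \<delta> u) = view d S f u" for u
    by (intro view_eq_if_shares_eq[OF S d, of f f', OF f]) blast
  then have "map_pmf (view d S f) (pmf_of_set keys) =
      map_pmf (view d S f') (map_pmf (shift_keys \<delta>) (pmf_of_set keys))"
    by (simp add: pmf.map_comp o_def)
  then show ?thesis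
    by (simp add: map_pmf_of_set_bij_betw[OF bij_betw_shift_keys keys_nonempty finite_keys])
qed

lemma finite_cached_idx: "S \<in> users h r \<Longrightarrow> finite (cached_idx S)"
  unfolding cached_idx_def by (intro finite_SigmaI) (auto simp: finite_user)

lemma card_cached_idx:
  assumes S: "S \<in> users h r"
  shows "card (cached_idx S) = r * D * key_len"
proof -
  have "card (cached_idx S) = (\<Sum>j\<in>S. card ({..<D} \<times> {T \<in> groups j s. S \<in> T}))"
    unfolding cached_idx_def using finite_user[OF S] by (intro card_SigmaI) auto
  also have "\<dots> = (\<Sum>j\<in>S. D * key_len)"
    by (intro sum.cong) (simp_all add: card_cartesian_product card_groups_containing(1)[OF S])
  finally show ?thesis using card_user[OF S] by simp
qed

sublocale scheme: secure_scheme h r D alphabet "pmf_of_set keys" V Z X Y "\<lambda>_. {()}"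
  "\<lambda>S. cached_idx S \<rightarrow>\<^sub>E {0..<p}" "\<lambda>j. groups j (Suc s) \<rightarrow>\<^sub>E {0..<p}"
  "\<lambda>j S. {T \<in> groups j (Suc s). S \<in> T} \<rightarrow>\<^sub>E {0..<p}"
proof
  show "finite alphabet" unfolding alphabet_def by (intro finite_PiE) auto
  show "alphabet \<noteq> {}" using p_pos by (simp add: alphabet_def PiE_eq_empty_iff)
  show "finite (set_pmf (pmf_of_set keys))" by (simp add: finite_keys keys_nonempty)
  show "X j d f u \<in> groups j (Suc s) \<rightarrow>\<^sub>E {0..<p}" for j d f u
    using p_pos by (simp add: X_def)
  show "Y j d S (X j d f u) (V j f u) \<in> {T \<in> groups j (Suc s). S \<in> T} \<rightarrow>\<^sub>E {0..<p}" for S j d f u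
    unfolding Y_def restrict_PiE_iff using p_pos by (simp add: X_def)
  show "Z S f u \<in> cached_idx S \<rightarrow>\<^sub>E {0..<p}" for S f u
    unfolding Z_def restrict_PiE_iff by (simp add: case_prod_unfold share_in del: atLeastLessThan_iff)
next
  fix S d f f' u u'
  assume S: "S \<in> users h r" and d: "d \<in> demands h r D"
    and f: "f \<in> {..<D} \<rightarrow> alphabet" "f' \<in> {..<D} \<rightarrow> alphabet"
    and view: "view d S f u = view d S f' u'"
  show "f (d S) = f' (d S)"
  proof (rule file_eq_if_messages_eq[OF S])
    show "f (d S) \<in> alphabet" "f' (d S) \<in> alphabet" using f d S by (auto simp: demands_def)
    show "message (f (d S)) j l = message (f' (d S)) j l" if j: "j \<in> S" and l: "l < msg_len" for j l
      by (rule message_eq_if_shares_eq[OF relay_less[OF S j] share_eq_if_view_eq[OF S d view j] l])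
  qed
next
  show "map_pmf (view d S f) (pmf_of_set keys) = map_pmf (view d S f') (pmf_of_set keys)"
    if "S \<in> users h r" "d \<in> demands h r D" "f (d S) = f' (d S)" for S d f f'
    using that by (rule map_view_keys_eq)
qed (auto simp: V_def finite_cached_idx intro: finite_PiE)

lemma secure_code_secret_sharing:
  "secure_code h r D (nat p ^ (r * msg_len)) (nat p ^ 0) (nat p ^ (r * D * key_len))
    (nat p ^ (Khat h r choose Suc s)) (nat p ^ msg_len)"
proof -
  have "card alphabet = nat p ^ (r * msg_len)"
    by (simp add: alphabet_def card_PiE card_cartesian_product)
  moreover have "secure_code h r D (card alphabet) (nat p ^ 0) (nat p ^ (r * D * key_len))
    (nat p ^ (Khat h r choose Suc s)) (nat p ^ msg_len)"
    by (rule scheme.secure_code)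
      (simp_all add: card_PiE finite_cached_idx card_cached_idx card_user_groups[OF r_pos]
        card_groups_containing(2))
  ultimately show ?thesis by simp
qed

end

section \<open>The achievable rates\<close>

lemma residue_code_of_nat:
  assumes "0 < r" and "0 < p" and "[p = 1] (mod fact (node_bound h r))"
  shows "residue_code h r (int p)"
proof
  have "[int p = 1] (mod fact (node_bound h r))"
    using assms(3) cong_int_iff[of p 1 "fact (node_bound h r)"] by simp
  then show "pairwise (\<lambda>x y. coprime (int p) (x - y)) (int ` {..<node_bound h r})"
    by (rule pairwise_coprime_diff_if_cong_1_mod_fact)
qed (use assms in simp_all)

lemma relay_cached_in_secure_rate_region:
  assumes "0 < r"
  shows "(real D / r, 0, 0, 1 / r) \<in> secure_rate_region h r D"
proof -
  have "secure_code h r D (p ^ r) (p ^ D) (p ^ 0) (p ^ 0) (p ^ 1)"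
    if "0 < p" "[p = 1] (mod fact (node_bound h r))" for p
    using residue_code.secure_code_relay_cached[OF residue_code_of_nat[OF assms that]] by simp
  from rates_of_power_codes_in_secure_rate_region[OF fact_gt_zero assms this] show ?thesis by simp
qed

lemma real_choose_diff_choose_pred:
  assumes "s < K"
  shows "real ((K choose s) - ((K - 1) choose s)) = real s / (real K - real s) * real ((K - 1) choose s)"
proof -
  have "((K - 1) choose s) \<le> (K choose s)" by (cases K; cases s) simp_all
  moreover have "(real K - real s) * real (K choose s) = real K * real ((K - 1) choose s)"
    using assms arg_cong[OF binomial_absorb_comp[of K s], of real] by (simp add: of_nat_diff)
  ultimately show ?thesis using assms by (simp add: of_nat_diff field_simps)
qed

lemma real_choose_Suc:
  assumes "0 < K"
  shows "real (K choose Suc s) = real K / (real s + 1) * real ((K - 1) choose s)"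
  using arg_cong[OF binomial_absorption[of s K], of real] by (simp add: field_simps)

lemma secret_sharing_in_secure_rate_region:
  assumes r: "0 < r" and s: "s < Khat h r"
  defines "K \<equiv> real (Khat h r)"
  shows "(0, real s * D / (K - s), K / (r * (real s + 1)), 1 / r) \<in> secure_rate_region h r D"
proof -
  define c where "c = ((Khat h r - 1) choose s)"
  define k where "k = (Khat h r choose s) - c"
  have c: "0 < c" using s by (simp add: c_def)
  have "secure_code h r D (p ^ (r * c)) (p ^ 0) (p ^ (r * D * k)) (p ^ (Khat h r choose Suc s)) (p ^ c)"
    if "0 < p" "[p = 1] (mod fact (node_bound h r))" for p
  proof -
    interpret secret_sharing_code h r D "int p" s
      by (intro secret_sharing_code.intro secret_sharing_code_axioms.intro residue_code_of_nat[OF r that] s)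
    show ?thesis
      using secure_code_secret_sharing by (simp add: msg_len_def key_len_def c_def k_def)
  qed
  from rates_of_power_codes_in_secure_rate_region[OF fact_gt_zero _ this]
  have "(real 0 / real (r * c), real (r * D * k) / real (r * c),
      real (Khat h r choose Suc s) / real (r * c), real c / real (r * c)) \<in> secure_rate_region h r D"
    using r c by simp
  moreover have "real (r * D * k) / real (r * c) = real s * D / (K - s)"
    using real_choose_diff_choose_pred[OF s, folded c_def, folded k_def] r c by (simp add: K_def)
  moreover have "real (Khat h r choose Suc s) / real (r * c) = K / (r * (real s + 1))"
    using c s by (subst real_choose_Suc[of "Khat h r" s, folded c_def]) (simp_all add: K_def mult.commute)
  ultimately show ?thesis using c by simp
qed

lemma R1c_eq:
  assumes "0 < r" "0 < D" "s < Khat h r"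
  shows "R1c h r D N s = (1 - N * r / D) * (Khat h r / (r * (real s + 1)))"
proof (cases "1 - N * r / D = 0")
  case True
  then show ?thesis unfolding R1c_def Let_def by (simp only: mult_zero_right mult_zero_left)
next
  case False
  define w where "w = 1 - N * r / D"
  define K where "K = real (Khat h r)"
  have w: "w \<noteq> 0" and K: "real s < K" using False assms(3) by (simp_all add: w_def K_def)
  have DN: "real D - real r * N = D * w" using assms(2) by (simp add: w_def field_simps)
  have M: "Mc h r D N s = s * D * w / (K - s)" by (simp add: Mc_def w_def K_def)
  have "D * w + Mc h r D N s = D * w * K / (K - s)"
    "(K + 1) * Mc h r D N s + D * w = D * w * K * (real s + 1) / (K - s)"
    using K by (simp_all add: M field_simps)
  then have "real D + Mc h r D N s - real r * N = D * w * K / (K - s)"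
    "(K + 1) * Mc h r D N s + real D - real r * N = D * w * K * (real s + 1) / (K - s)"
    using DN by linarith+
  then show ?thesis
    using K w assms(1,2) by (simp add: R1c_def Let_def K_def[symmetric] w_def[symmetric])
qed

theorem coded_rates_in_secure_rate_region:
  assumes "0 < r" and "0 < D" and "0 \<le> N" and "N \<le> D / r" and "s < Khat h r"
  shows "(N, Mc h r D N s, R1c h r D N s, 1 / r) \<in> secure_rate_region h r D"
proof -
  let ?K = "real (Khat h r)"
  define w where "w = N * r / D"
  have w: "0 \<le> w" "0 \<le> 1 - w" using assms by (simp_all add: w_def field_simps)
  have "w *\<^sub>R (real D / r, 0, 0, 1 / r) + 
        (1 - w) *\<^sub>R (0, real s * D / (?K - s), ?K / (r * (real s + 1)), 1 / r)
      \<in> secure_rate_region h r D"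
    by (rule convexD[OF convex_secure_rate_region relay_cached_in_secure_rate_region[OF assms(1)]
          secret_sharing_in_secure_rate_region[OF assms(1,5)] w]) simp
  moreover have "w * (real D / r) = N" using assms(1,2) by (simp add: w_def)
  moreover have "w * (1 / r) + (1 - w) * (1 / r) = 1 / r" by (simp flip: add_divide_distrib)
  ultimately show ?thesis
    using R1c_eq[OF assms(1,2,5), of N] by (simp add: Mc_def w_def mult.commute add.commute)
qed

lemma convex_vimage_Pair:
  assumes "convex A"
  shows "convex (Pair a -` A)"
proof (rule convexI)
  fix x y and u v :: real
  assume xy: "x \<in> Pair a -` A" "y \<in> Pair a -` A" and uv: "0 \<le> u" "0 \<le> v" "u + v = 1"
  have "u *\<^sub>R (a, x) + v *\<^sub>R (a, y) \<in> A"
    using xy by (intro convexD[OF assms _ _ uv]) auto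
  moreover have "u *\<^sub>R a + v *\<^sub>R a = a"
    using uv(3) by (simp flip: scaleR_left_distrib)
  ultimately show "u *\<^sub>R x + v *\<^sub>R y \<in> Pair a -` A" by simp
qed

theorem theorem4:
  fixes h r D t :: nat and N :: real
  assumes "0 < r" and "r < h" and "h choose r \<le> D"
    and "0 \<le> N" and "N \<le> real D / real r"
    and "t < Khat h r"
  shows "secure_achievable h r D (Mc h r D N t) N (R1c h r D N t) (1 / real r) \<and>
    (\<forall>p \<in> convex hull {(Mc h r D N s, R1c h r D N s, 1 / real r) | s. s < Khat h r}.
       secure_achievable h r D (fst p) N (fst (snd p)) (snd (snd p)))"
proof (intro conjI ballI)
  have "0 < h choose r" using assms(2) by simp
  then have D: "0 < D" using assms(3) by linarith
  note coded = coded_rates_in_secure_rate_region[OF assms(1) D assms(4,5)]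
  show "secure_achievable h r D (Mc h r D N t) N (R1c h r D N t) (1 / real r)"
    by (rule secure_achievable_if_in_secure_rate_region[OF coded[OF assms(6)]])
  fix p assume p: "p \<in> convex hull {(Mc h r D N s, R1c h r D N s, 1 / real r) | s. s < Khat h r}"
  have "convex (Pair N -` secure_rate_region h r D)"
    by (intro convex_vimage_Pair convex_secure_rate_region)
  moreover have "{(Mc h r D N s, R1c h r D N s, 1 / real r) | s. s < Khat h r}
      \<subseteq> Pair N -` secure_rate_region h r D"
    using coded by auto
  ultimately have "p \<in> Pair N -` secure_rate_region h r D"
    using p hull_minimal by blast
  then show "secure_achievable h r D (fst p) N (fst (snd p)) (snd (snd p))"
    by (intro secure_achievable_if_in_secure_rate_region) simp
qed

end
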